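(* In the setting described in the context, suppose that $X_i$ is convex for all $i=1,\dots,n$. Run the Frank-Wolfe stage for $K\ge1$ iterations with target $z^*=(v^*,b)$, followed by the approximate trimming stage for $T\ge n-1$ iterations, and assume that $$\frac1n>h_0\exp\Big(-\frac T8\,\frac{\delta}{D_{\mathcal A_K}^2}\Big).$$ Let $\bar x\in\mathbb{R}^d$ be defined by $\bar x_i=\sum_{l\in I_i}\alpha_ly_i^{k_l}$, $i=1,\dots,n$. Then $$\sum_{i=1}^nf_i(\bar x_i)\le v^*+\frac{2D_{\mathcal C}}{\sqrt{K+1}}+\mathrm{Err}_f(n,T)+(T+1-n)\max_i\rho(f_i),$$ $$\Big\|\sum_{i=1}^nA_i\bar x_i-b\Big\|_+\le\frac{2D_{\mathcal C}}{\sqrt{K+1}}+\mathrm{Err}_A(n,T),$$ where $$\mathrm{Err}_f(n,T)=n\Big(\sqrt n\max_{i,\,y\in X_i}|f_i(y)|+1\Big)h_0\exp\Big(-\frac{T\delta}{8D_{\mathcal A_K}^2}\Big),$$ $$\mathrm{Err}_A(n,T)=n\Big(\sqrt n\max_{i,\,y\in X_i}\|A_iy\|+1\Big)h_0\exp\Big(-\frac{T\delta}{8D_{\mathcal A_K}^2}\Big).$$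
   Context: Setting. For $i=1,\dots,n$, $f_i:\mathbb{R}^{d_i}\to\mathbb{R}\cup\{+\infty\}$ is proper, lower semicontinuous, has an affine minorant, and $X_i=\operatorname{dom}f_i$ is compact. $A_i\in\mathbb{R}^{m\times d_i}$, $b\in\mathbb{R}^m$, $d=\sum_id_i$, $A=[A_1\cdots A_n]$. Vector inequalities are componentwise. $f_i^{**}$ is the Fenchel biconjugate, with $\operatorname{dom}f_i^{**}=\operatorname{conv}X_i$. For a vector $x$, $\|x\|_+=\sqrt{\sum_j\max(x_j,0)^2}$; $\|\cdot\|$ is the Euclidean norm. $\Delta_K=\{\gamma\in\mathbb{R}^K_+:\sum_k\gamma_k=1\}$. Nonconvexity: $\rho(f)=\sup\{f(\sum_{j=1}^p\alpha_jx_j)-\sum_{j=1}^p\alpha_jf(x_j): p\in\mathbb{N},\ x_j\in\operatorname{dom}f,\ \alpha\in\Delta_p\}$. Dual value: $\Psi(\lambda)=\inf_{x_i\in X_i}\{\sum_if_i(x_i)+\lambda^\top(\sum_iA_ix_i-b)\}$ and $v^*=\max_{\lambda\ge0}\Psi(\lambda)$. Strong duality is assumed: $v^*$ equals the optimal value of the problem of minimizing $\sum_if_i^{**}(x_i)$ subject to $Ax\le b$, $x_i\in\operatorname{conv}X_i$. Sets: $\mathcal C_i=\{(f_i^{**}(x_i),A_ix_i):x_i\in\operatorname{conv}X_i\}\subset\mathbb{R}^{1+m}$, $\mathcal C=\sum_i\mathcal C_i$ (Minkowski sum), $D_{\mathcal C}=\sup_{z,z'\in\mathcal C}\|z-z'\|$.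 Frank-Wolfe stage with target $z^*\in\mathbb{R}^{1+m}$. Start from $z^0=\sum_i(f_i(y_i),A_iy_i)$ for some $y_i\in X_i$ with $f_i(y_i)=f_i^{**}(y_i)$. For $k=0,\dots,K-1$: let $v^k=\max(z^k-z^*,0)$ componentwise, written $v^k=(\alpha_k,g^k)\in\mathbb{R}\times\mathbb{R}^m$; for each $i$ choose $y_i^k\in\arg\min_{x_i\in\operatorname{conv}X_i}\{\alpha_kf_i^{**}(x_i)+(g^k)^\top A_ix_i\}$, chosen so that $y_i^k\in X_i$ and $f_i(y_i^k)=f_i^{**}(y_i^k)$ (this choice is a standing assumption); set $s^k=\sum_i(f_i(y_i^k),A_iy_i^k)$ and $z^{k+1}=(1-\eta_k)z^k+\eta_ks^k$, where either $\eta_k=\frac{2}{k+2}$ for all $k$, or $\eta_k=\min\big(1,\frac{(v^k)^\top(z^k-s^k)}{\|z^k-s^k\|^2}\big)$ for all $k$ (any value in $[0,1]$ if $z^k=s^k$). The output is written $z^K=\sum_{k=0}^{K-1}\gamma_ks^k$ with $\gamma\in\Delta_K$ (this representation is part of the setting). Approximate trimming stage. Let $w^K=(z^K,\mathbf 1_n)\in\mathbb{R}^{1+m+n}$ and $\mathcal A_K=\{(f_i(y_i^k),A_iy_i^k,e_i):0\le k\le K-1,\ 1\le i\le n\}$, with $e_i$ the canonical basis of $\mathbb{R}^n$; then $w^K/n\in\operatorname{conv}\mathcal A_K$. The fully corrective Frank-Wolfe method starts from some $w^{K,0}=s^0\in\mathcal A_K$; for $t=1,\dots,T$ it picks (reusing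 the letter $s$) $s^t\in\arg\min_{s\in\mathcal A_K}s^\top(w^{K,t-1}-w^K/n)$, picks $\beta^t\in\arg\min\{\frac12\|\sum_{l=0}^t\beta_ls^l-w^K/n\|^2:\beta\ge0,\ \sum_l\beta_l=1\}$, and sets $w^{K,t}=\sum_{l=0}^t\beta^t_ls^l$. Write the output, with $\beta=\beta^T$ and $s^l=(f_{i_l}(y_{i_l}^{k_l}),A_{i_l}y_{i_l}^{k_l},e_{i_l})$, as $w^{K,T}=\sum_{l=0}^T\beta_ls^l$; set $I_i=\{l:i_l=i\}$ and $\alpha_l=\beta_l/\sum_{l'\in I_{i_l}}\beta_{l'}$. Constants. $h_0=\|w^{K,0}-w^K/n\|$; $D_{\mathcal A_K}$ is the diameter of $\operatorname{conv}\mathcal A_K$; $\delta=\max(\omega^2,r^2)$, where $r$ is the radius of the largest relative ball (ball intersected with the affine hull of $\mathcal A_K$) centered at $w^K/n$ contained in $\operatorname{conv}\mathcal A_K$, and $\omega=\min\operatorname{dist}(F,\operatorname{conv}(\mathcal A_K\setminus F))$, the minimum being over faces $F$ of $\operatorname{conv}\mathcal A_K$ with $\emptyset\subsetneq F\subsetneq\operatorname{conv}\mathcal A_K$ (facial distance). $\mathcal A_K$ is understood to have at least two points so that these are defined. *)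

theory Defs
  imports "HOL-Analysis.Analysis"
begin

section \<open>Extended-valued functions\<close>

definition edom :: "('a \<Rightarrow> ereal) \<Rightarrow> 'a set" where
  "edom f = {x. f x < \<infinity>}"

definition proper :: "('a \<Rightarrow> ereal) \<Rightarrow> bool" where
  "proper f \<longleftrightarrow> edom f \<noteq> {} \<and> (\<forall>x. f x > -\<infinity>)"

definition lsc :: "('a::topological_space \<Rightarrow> ereal) \<Rightarrow> bool" where
  "lsc f \<longleftrightarrow> (\<forall>x. f x \<le> Liminf (at x) f)"

definition has_affine_minorant :: "('a::real_inner \<Rightarrow> ereal) \<Rightarrow> bool" where
  "has_affine_minorant f \<longleftrightarrow> (\<exists>a c. \<forall>x. ereal (a \<bullet> x + c) \<le> f x)"

definition conjugate :: "('a::real_inner \<Rightarrow> ereal) \<Rightarrow> 'a \<Rightarrow> ereal" where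
  "conjugate f u = (SUP x. ereal (u \<bullet> x) - f x)"

definition biconjugate :: "('a::real_inner \<Rightarrow> ereal) \<Rightarrow> 'a \<Rightarrow> ereal" where
  "biconjugate f = conjugate (conjugate f)"

text \<open>The unit simplex in \<open>\<real>\<^sup>p\<close>; only the entries with index below \<open>p\<close> matter.\<close>

definition unit_simplex :: "nat \<Rightarrow> (nat \<Rightarrow> real) set" where
  "unit_simplex p = {c. (\<forall>j<p. 0 \<le> c j) \<and> (\<Sum>j<p. c j) = 1}"

definition nonconvexity :: "('a::real_vector \<Rightarrow> ereal) \<Rightarrow> ereal" where
  "nonconvexity f =
     (SUP (p, x, c) \<in> {(p, x, c). (\<forall>j<p. x j \<in> edom f) \<and> c \<in> unit_simplex p}.
        f (\<Sum>j<p. c j *\<^sub>R x j) - (\<Sum>j<p. ereal (c j) * f (x j)))"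

definition norm_plus :: "real ^ 'm \<Rightarrow> real" where
  "norm_plus x = sqrt (\<Sum>j\<in>UNIV. (max (x $ j) 0)\<^sup>2)"


section \<open>The separable problem\<close>

text \<open>
  The blocks may have different dimensions. The coordinates \<open>'d\<close> of the full space
  are partitioned by \<open>blk :: 'd \<Rightarrow> 'n\<close>, and the space of block \<open>i\<close>, of dimension
  \<open>card {j. blk j = i}\<close>, is the coordinate subspace \<open>block_space blk i\<close>. A function
  \<open>f\<^sub>i\<close> on that space is extended by \<open>\<infinity>\<close> to all of \<open>real ^ 'd\<close>; this changes
  neither its domain nor the biconjugate on the block space, and the biconjugate of the
  extension is \<open>\<infinity>\<close> off it. The matrix \<open>A = [A\<^sub>1 \<dots> A\<^sub>n]\<close> satisfies \<open>A *v x = A\<^sub>i x\<close>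
  for \<open>x\<close> in the space of block \<open>i\<close>.
\<close>

definition block_space :: "('d::finite \<Rightarrow> 'n) \<Rightarrow> 'n \<Rightarrow> (real ^ 'd) set" where
  "block_space blk i = {x. \<forall>j. blk j \<noteq> i \<longrightarrow> x $ j = 0}"

definition block :: "('d::finite \<Rightarrow> 'n) \<Rightarrow> 'n \<Rightarrow> real ^ 'd \<Rightarrow> real ^ 'd" where
  "block blk i x = (\<chi> j. if blk j = i then x $ j else 0)"

definition dual_function ::
  "('d::finite \<Rightarrow> 'n::finite) \<Rightarrow> ('n \<Rightarrow> real ^ 'd \<Rightarrow> ereal) \<Rightarrow> real ^ 'd ^ 'm \<Rightarrow> real ^ 'm
     \<Rightarrow> real ^ 'm \<Rightarrow> ereal" where
  "dual_function blk f A b u =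
     (INF x \<in> {x. \<forall>i. block blk i x \<in> edom (f i)}.
        (\<Sum>i\<in>UNIV. f i (block blk i x)) + ereal (u \<bullet> ((\<Sum>i\<in>UNIV. A *v block blk i x) - b)))"

definition is_dual_max ::
  "('d::finite \<Rightarrow> 'n::finite) \<Rightarrow> ('n \<Rightarrow> real ^ 'd \<Rightarrow> ereal) \<Rightarrow> real ^ 'd ^ 'm \<Rightarrow> real ^ 'm
     \<Rightarrow> real \<Rightarrow> bool" where
  "is_dual_max blk f A b v \<longleftrightarrow>
     (\<exists>u\<ge>0. dual_function blk f A b u = ereal v) \<and>
     (\<forall>u\<ge>0. dual_function blk f A b u \<le> ereal v)"

definition convexified_value ::
  "('d::finite \<Rightarrow> 'n::finite) \<Rightarrow> ('n \<Rightarrow> real ^ 'd \<Rightarrow> ereal) \<Rightarrow> real ^ 'd ^ 'm \<Rightarrow> real ^ 'm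
     \<Rightarrow> ereal" where
  "convexified_value blk f A b =
     (INF x \<in> {x. A *v x \<le> b \<and> (\<forall>i. block blk i x \<in> convex hull edom (f i))}.
        \<Sum>i\<in>UNIV. biconjugate (f i) (block blk i x))"

text \<open>\<open>real_of_ereal\<close> is harmless below: \<open>f\<^sub>i\<close> is finite on its domain and its
  biconjugate is finite on the convex hull of the domain.\<close>

definition C_block ::
  "('n \<Rightarrow> real ^ 'd::finite \<Rightarrow> ereal) \<Rightarrow> real ^ 'd ^ 'm \<Rightarrow> 'n \<Rightarrow> (real \<times> (real ^ 'm)) set" where
  "C_block f A i =
     {(real_of_ereal (biconjugate (f i) x), A *v x) | x. x \<in> convex hull edom (f i)}"

definition C_set ::
  "('n::finite \<Rightarrow> real ^ 'd::finite \<Rightarrow> ereal) \<Rightarrow> real ^ 'd ^ 'm \<Rightarrow> (real \<times> (real ^ 'm)) set" where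
  "C_set f A = {\<Sum>i\<in>UNIV. c i | c. \<forall>i. c i \<in> C_block f A i}"

text \<open>Extended-valued, since \<open>f\<^sub>i\<close> and its biconjugate, although finite on compact
  domains, need not be bounded above there. The same applies to \<open>max_abs_value\<close>.\<close>

definition D_C ::
  "('n::finite \<Rightarrow> real ^ 'd::finite \<Rightarrow> ereal) \<Rightarrow> real ^ 'd ^ 'm \<Rightarrow> ereal" where
  "D_C f A = (SUP z \<in> C_set f A. SUP z' \<in> C_set f A. ereal (norm (z - z')))"

definition max_abs_value :: "('n::finite \<Rightarrow> real ^ 'd::finite \<Rightarrow> ereal) \<Rightarrow> ereal" where
  "max_abs_value f = (SUP i. SUP y \<in> edom (f i). \<bar>f i y\<bar>)"

definition max_norm_image ::
  "('n::finite \<Rightarrow> real ^ 'd::finite \<Rightarrow> ereal) \<Rightarrow> real ^ 'd ^ 'm \<Rightarrow> ereal" where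
  "max_norm_image f A = (SUP i. SUP y \<in> edom (f i). ereal (norm (A *v y)))"


section \<open>Frank-Wolfe stage\<close>

definition aggregate ::
  "('n::finite \<Rightarrow> real ^ 'd::finite \<Rightarrow> ereal) \<Rightarrow> real ^ 'd ^ 'm \<Rightarrow> ('n \<Rightarrow> real ^ 'd)
     \<Rightarrow> real \<times> (real ^ 'm)" where
  "aggregate f A y = (\<Sum>i\<in>UNIV. (real_of_ereal (f i (y i)), A *v y i))"

definition open_loop_steps :: "nat \<Rightarrow> (nat \<Rightarrow> real) \<Rightarrow> bool" where
  "open_loop_steps K \<eta> \<longleftrightarrow> (\<forall>k<K. \<eta> k = 2 / (real k + 2))"

definition short_steps ::
  "nat \<Rightarrow> (nat \<Rightarrow> 'a::real_inner) \<Rightarrow> (nat \<Rightarrow> 'a) \<Rightarrow> (nat \<Rightarrow> 'a) \<Rightarrow> (nat \<Rightarrow> real) \<Rightarrow> bool" where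
  "short_steps K v z s \<eta> \<longleftrightarrow>
     (\<forall>k<K. if z k = s k then \<eta> k \<in> {0..1}
            else \<eta> k = min 1 ((v k \<bullet> (z k - s k)) / (norm (z k - s k))\<^sup>2))"

text \<open>\<open>sup _ 0\<close> on \<open>\<real> \<times> \<real>\<^sup>m\<close> is the componentwise positive part.\<close>

definition frank_wolfe_stage ::
  "('n::finite \<Rightarrow> real ^ 'd::finite \<Rightarrow> ereal) \<Rightarrow> real ^ 'd ^ 'm \<Rightarrow> real \<times> (real ^ 'm) \<Rightarrow> nat
     \<Rightarrow> ('n \<Rightarrow> real ^ 'd) \<Rightarrow> (nat \<Rightarrow> 'n \<Rightarrow> real ^ 'd) \<Rightarrow> (nat \<Rightarrow> real)
     \<Rightarrow> (nat \<Rightarrow> real \<times> (real ^ 'm)) \<Rightarrow> bool" where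
  "frank_wolfe_stage f A zstar K y0 y \<eta> z \<longleftrightarrow>
     (let v = (\<lambda>k. sup (z k - zstar) 0); s = (\<lambda>k. aggregate f A (y k)) in
       (\<forall>i. y0 i \<in> edom (f i) \<and> f i (y0 i) = biconjugate (f i) (y0 i)) \<and>
       z 0 = aggregate f A y0 \<and>
       (\<forall>k<K. \<forall>i.
          is_arg_min
            (\<lambda>x. ereal (fst (v k)) * biconjugate (f i) x + ereal (snd (v k) \<bullet> (A *v x)))
            (\<lambda>x. x \<in> convex hull edom (f i)) (y k i) \<and>
          y k i \<in> edom (f i) \<and> f i (y k i) = biconjugate (f i) (y k i)) \<and>
       (\<forall>k<K. z (Suc k) = (1 - \<eta> k) *\<^sub>R z k + \<eta> k *\<^sub>R s k) \<and>
       (open_loop_steps K \<eta> \<or> short_steps K v z s \<eta>))"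


section \<open>Approximate trimming stage\<close>

definition atom ::
  "('n::finite \<Rightarrow> real ^ 'd::finite \<Rightarrow> ereal) \<Rightarrow> real ^ 'd ^ 'm \<Rightarrow> (nat \<Rightarrow> 'n \<Rightarrow> real ^ 'd)
     \<Rightarrow> nat \<Rightarrow> 'n \<Rightarrow> real \<times> (real ^ 'm) \<times> (real ^ 'n)" where
  "atom f A y k i = (real_of_ereal (f i (y k i)), A *v y k i, axis i 1)"

definition atoms ::
  "('n::finite \<Rightarrow> real ^ 'd::finite \<Rightarrow> ereal) \<Rightarrow> real ^ 'd ^ 'm \<Rightarrow> (nat \<Rightarrow> 'n \<Rightarrow> real ^ 'd)
     \<Rightarrow> nat \<Rightarrow> (real \<times> (real ^ 'm) \<times> (real ^ 'n)) set" where
  "atoms f A y K = {atom f A y k i | k i. k < K}"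

text \<open>The point \<open>w\<^sup>K / n\<close>, where \<open>w\<^sup>K\<close> is \<open>z\<^sup>K\<close> followed by the all-ones vector.\<close>

definition trim_target :: "real \<times> (real ^ 'm) \<Rightarrow> real \<times> (real ^ 'm) \<times> (real ^ 'n::finite)" where
  "trim_target zK = (fst zK, snd zK, \<chi> i. 1) /\<^sub>R real CARD('n)"

text \<open>Fully corrective Frank-Wolfe for the projection of \<open>q\<close> onto the convex hull of \<open>P\<close>:
  \<open>s t\<close> is the atom chosen at step \<open>t\<close>, \<open>\<beta> t\<close> the weights on \<open>s 0, \<dots>, s t\<close>, and
  \<open>w t\<close> the iterate. The initial iterate \<open>w 0 = s 0\<close> has the single weight \<open>\<beta> 0 0 = 1\<close>,
  which is the output if \<open>T = 0\<close>.\<close>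

definition fully_corrective_stage ::
  "'a::real_inner set \<Rightarrow> 'a \<Rightarrow> nat \<Rightarrow> (nat \<Rightarrow> 'a) \<Rightarrow> (nat \<Rightarrow> nat \<Rightarrow> real) \<Rightarrow> (nat \<Rightarrow> 'a) \<Rightarrow> bool"
  where
  "fully_corrective_stage P q T s \<beta> w \<longleftrightarrow>
     s 0 \<in> P \<and> w 0 = s 0 \<and> \<beta> 0 0 = 1 \<and>
     (\<forall>t\<in>{1..T}.
        is_arg_min (\<lambda>a. a \<bullet> (w (t - 1) - q)) (\<lambda>a. a \<in> P) (s t) \<and>
        is_arg_min (\<lambda>c. 1 / 2 * (norm ((\<Sum>l\<le>t. c l *\<^sub>R s l) - q))\<^sup>2)
          (\<lambda>c. c \<in> unit_simplex (Suc t)) (\<beta> t) \<and>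
        w t = (\<Sum>l\<le>t. \<beta> t l *\<^sub>R s l))"

definition facial_distance :: "'a::euclidean_space set \<Rightarrow> real" where
  "facial_distance P =
     Min {setdist F (convex hull (P - F)) | F.
            F face_of (convex hull P) \<and> F \<noteq> {} \<and> F \<noteq> convex hull P}"

definition relative_radius :: "'a::euclidean_space \<Rightarrow> 'a set \<Rightarrow> real" where
  "relative_radius x P = Sup {r. 0 \<le> r \<and> cball x r \<inter> affine hull P \<subseteq> convex hull P}"

text \<open>The common form of the two trimming errors, for a bound \<open>M\<close> on the relevant
  components of the atoms.\<close>

definition Err :: "nat \<Rightarrow> nat \<Rightarrow> ereal \<Rightarrow> real \<Rightarrow> real \<Rightarrow> real \<Rightarrow> ereal" where
  "Err n T M h0 \<delta> D =
     ereal (real n) * (ereal (sqrt (real n)) * M + 1) * ereal h0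
       * ereal (exp (- (real T * \<delta> / (8 * D\<^sup>2))))"

end

theory Submission
  imports Defs
begin

text \<open>
  The Frank-Wolfe stage minimizes the squared norm of the positive part of \<open>z - z*\<close>, whose infimum
  over \<open>C\<close> is \<open>0\<close> by strong duality; the classical recursion gives the bound
  \<open>2 D\<^sub>C / sqrt (K + 1)\<close> for both step rules. In the trimming stage the weights are optimal, so all
  active atoms have the same inner product with the residual \<open>g = w - q\<close>. Hence the Frank-Wolfe gap
  equals the pairwise gap and is at least \<open>\<omega> \<parallel>g\<parallel>\<close>; it is at least \<open>r \<parallel>g\<parallel>\<close> because \<open>q\<close> is
  the center of a relative ball. Each step therefore contracts \<open>\<parallel>g\<parallel>\<^sup>2\<close> by \<open>exp (- \<delta> / D\<^sup>2)\<close>.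
  The accuracy condition makes the weight of every block positive, so that each block is used at least
  once and at most \<open>T + 1 - n\<close> atoms are left over to cause convexity defects; normalizing the block
  weights, which are close to \<open>1 / n\<close>, produces the two error terms.
\<close>

subsection \<open>Facial distance and relative radius as lower bounds on the Frank-Wolfe gap\<close>

lemma inner_le_convex_hull:
  fixes g :: "'a::real_inner"
  assumes "u \<in> convex hull S" and "\<And>a. a \<in> S \<Longrightarrow> g \<bullet> a \<le> c"
  shows "g \<bullet> u \<le> c"
proof -
  have "convex hull S \<subseteq> {x. g \<bullet> x \<le> c}"
    by (rule hull_minimal) (use assms(2) in \<open>auto simp: convex_halfspace_le\<close>)
  then show ?thesis using assms(1) by auto
qed

lemma inner_ge_convex_hull:
  fixes g :: "'a::real_inner"
  assumes "u \<in> convex hull S" and "\<And>a. a \<in> S \<Longrightarrow> c \<le> g \<bullet> a"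
  shows "c \<le> g \<bullet> u"
  using inner_le_convex_hull[of u S "- g" "- c"] assms by auto

text \<open>\<open>Min\<close> is meaningful only on a finite nonempty set: the hull of a finite set
  is a polytope with finitely many faces, and \<open>F\<close> itself is a witness for nonemptiness,
  which nonnegativity also relies on.\<close>

lemma facial_distance_le_setdist:
  fixes P :: "'a::euclidean_space set"
  assumes "finite P" "F face_of (convex hull P)" "F \<noteq> {}" "F \<noteq> convex hull P"
  shows "0 \<le> facial_distance P" and "facial_distance P \<le> setdist F (convex hull (P - F))"
proof -
  let ?M = "{setdist F (convex hull (P - F)) | F.
            F face_of (convex hull P) \<and> F \<noteq> {} \<and> F \<noteq> convex hull P}"
  have "finite {F. F face_of (convex hull P)}"
    using finite_polytope_faces[of "convex hull P"] assms(1) by (auto simp: polytope_def)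
  moreover have "?M \<subseteq> (\<lambda>F. setdist F (convex hull (P - F))) ` {F. F face_of (convex hull P)}"
    by auto
  ultimately have fin: "finite ?M"
    using finite_surj by blast
  have mem: "setdist F (convex hull (P - F)) \<in> ?M"
    using assms by blast
  show "facial_distance P \<le> setdist F (convex hull (P - F))"
    unfolding facial_distance_def using fin mem by (rule Min_le)
  have "Min ?M \<in> ?M"
    using fin mem by (intro Min_in) auto
  then show "0 \<le> facial_distance P"
    unfolding facial_distance_def by (auto simp: setdist_pos_le)
qed

text \<open>Projecting a point slightly beyond the end of the ray from \<open>0\<close> in direction \<open>w - q\<close> in
  \<open>conv S - conv P\<close> gives \<open>u - v\<close> and a normal vector whose minimal face \<open>F\<close> on \<open>conv P\<close> contains
  \<open>v\<close>, while \<open>u\<close> is in the convex hull of atoms outside \<open>F\<close>.\<close>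

lemma facial_distance_le_gap:
  fixes P :: "'a::euclidean_space set"
  assumes fin: "finite P" and SP: "S \<subseteq> P"
    and w: "w \<in> convex hull S" and q: "q \<in> convex hull P" and neq: "w \<noteq> q"
    and upper: "\<And>a. a \<in> S \<Longrightarrow> (w - q) \<bullet> a \<le> c"
    and lower: "\<And>p. p \<in> P \<Longrightarrow> c' \<le> (w - q) \<bullet> p"
  shows "0 \<le> facial_distance P" and "facial_distance P * norm (w - q) \<le> c - c'"
proof -
  define d where "d = sgn (w - q)"
  define Z where "Z = {x - y | x y. x \<in> convex hull S \<and> y \<in> convex hull P}"
  have nd: "norm d = 1" and wq: "w - q = norm (w - q) *\<^sub>R d"
    using neq by (auto simp: d_def norm_sgn sgn_div_norm)
  have finS: "finite S" using fin SP finite_subset by blast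
  have hullSP: "convex hull S \<subseteq> convex hull P" using SP by (rule hull_mono)
  have compZ: "compact Z"
    unfolding Z_def
    by (rule compact_differences) (use fin finS in \<open>auto intro: finite_imp_compact_convex_hull\<close>)
  have convZ: "convex Z"
  proof -
    have "Z = (\<Union>x\<in>convex hull S. \<Union>y\<in>convex hull P. {x - y})"
      by (auto simp: Z_def)
    then show ?thesis
      using convex_differences[of "convex hull S" "convex hull P"] by simp
  qed
  \<comment> \<open>\<open>L\<close> is compact since \<open>Z\<close> is and \<open>d\<close> is a
    unit vector. Its maximum \<open>m\<close> is the parameter at which the ray leaves
    \<open>Z\<close>, and \<open>m\<close> is at least \<open>norm (w - q)\<close>.\<close>
  define L where "L = {t. t *\<^sub>R d \<in> Z}"
  have inL: "norm (w - q) \<in> L"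
    using w q wq unfolding L_def Z_def by auto
  have "closed L"
  proof -
    have "closed ((\<lambda>t. t *\<^sub>R d) -` Z)"
      by (intro continuous_closed_vimage compact_imp_closed compZ) (auto intro!: continuous_intros)
    then show ?thesis by (simp add: L_def vimage_def)
  qed
  moreover have "bounded L"
  proof -
    obtain B where "\<And>x. x \<in> Z \<Longrightarrow> norm x \<le> B"
      using compact_imp_bounded[OF compZ] unfolding bounded_iff by blast
    then show ?thesis
      unfolding bounded_iff L_def using nd by fastforce
  qed
  ultimately have "compact L" by (simp add: compact_eq_bounded_closed)
  then obtain m where m: "m \<in> L" "\<And>t. t \<in> L \<Longrightarrow> t \<le> m"
    using compact_attains_sup[of L] inL by blast
  have mpos: "m > 0" using m(2)[OF inL] neq by (smt (verit) zero_less_norm_iff right_minus_eq)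
  \<comment> \<open>The point at parameter \<open>m + e\<close> is outside \<open>Z\<close>, so its
    projection \<open>z\<close> comes with a nonzero normal \<open>p\<close> of norm at most
    \<open>e\<close>. The error \<open>2 * e\<close> in the norm of \<open>z\<close> disappears as
    \<open>e\<close> tends to \<open>0\<close>.\<close>
  have key: "0 \<le> facial_distance P \<and> facial_distance P \<le> m + 2 * e" if e: "e > 0" for e
  proof -
    define x where "x = (m + e) *\<^sub>R d"
    define z where "z = closest_point Z x"
    define p where "p = x - z"
    have md: "m *\<^sub>R d \<in> Z" using m(1) by (simp add: L_def)
    then have Zne: "Z \<noteq> {}" by auto
    have "x \<notin> Z" using m(2)[of "m + e"] e by (auto simp: x_def L_def)
    have zZ: "z \<in> Z" unfolding z_def by (rule closest_point_in_set[OF compact_imp_closed[OF compZ] Zne])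
    have pdot: "p \<bullet> (y - z) \<le> 0" if "y \<in> Z" for y
      unfolding p_def z_def using closest_point_dot[OF convZ compact_imp_closed[OF compZ] that] .
    have "p \<noteq> 0" using zZ \<open>x \<notin> Z\<close> by (auto simp: p_def)
    have np: "norm p \<le> e"
      using closest_point_le[OF compact_imp_closed[OF compZ] md, of x] e nd
      by (simp add: z_def p_def x_def dist_norm scaleR_left_distrib)
    obtain u v where uv: "u \<in> convex hull S" "v \<in> convex hull P" "z = u - v"
      using zZ by (auto simp: Z_def)
    have "p \<bullet> x - p \<bullet> z > 0"
      using \<open>p \<noteq> 0\<close> by (simp add: p_def inner_diff_right[symmetric])
    moreover have pz: "m * (p \<bullet> d) \<le> p \<bullet> z"
      using pdot[OF md] by (simp add: inner_diff_right)
    ultimately have "e * (p \<bullet> d) > 0"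
      by (simp add: x_def algebra_simps inner_add_right)
    then have "p \<bullet> d > 0" using e by (simp add: zero_less_mult_iff)
    then have "m * (p \<bullet> d) > 0" using mpos by simp
    \<comment> \<open>Since \<open>p \<bullet> z \<ge> m * (p \<bullet> d) > 0\<close>, the value of
      \<open>p\<close> at \<open>u\<close> is strictly above its minimum over \<open>conv P\<close>,
      which is attained at \<open>v\<close>.\<close>
    then have puv: "p \<bullet> u > p \<bullet> v" using pz uv(3) by (simp add: inner_diff_right)
    define F where "F = convex hull P \<inter> {y. p \<bullet> y = p \<bullet> v}"
    have Fface: "F face_of convex hull P"
      unfolding F_def
    proof (rule face_of_Int_supporting_hyperplane_ge)
      show "p \<bullet> y \<ge> p \<bullet> v" if "y \<in> convex hull P" for y
        using pdot[of "u - y"] that uv by (auto simp: Z_def inner_diff_right)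
    qed auto
    have "v \<in> F" using uv by (auto simp: F_def)
    have "u \<notin> F" "u \<in> convex hull P" using puv uv hullSP by (auto simp: F_def)
    then have fd: "0 \<le> facial_distance P" "facial_distance P \<le> setdist F (convex hull (P - F))"
      using facial_distance_le_setdist[OF fin Fface] \<open>v \<in> F\<close> by auto
    \<comment> \<open>\<open>u\<close> maximizes \<open>p\<close> over \<open>conv S\<close>, so it
      is a combination of atoms \<open>S'\<close> that all have the value
      \<open>p \<bullet> u\<close>; none of them is in \<open>F\<close>.\<close>
    have "(convex hull S \<inter> {y. p \<bullet> y = p \<bullet> u}) face_of convex hull S"
    proof (rule face_of_Int_supporting_hyperplane_le)
      show "p \<bullet> y \<le> p \<bullet> u" if "y \<in> convex hull S" for y
        using pdot[of "y - v"] that uv by (auto simp: Z_def inner_diff_right)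
    qed auto
    then obtain S' where S': "S' \<subseteq> S" "convex hull S \<inter> {y. p \<bullet> y = p \<bullet> u} = convex hull S'"
      using face_of_convex_hull_subset[OF finite_imp_compact[OF finS]] by blast
    have "S' \<subseteq> P - F"
    proof
      fix a assume "a \<in> S'"
      then have "p \<bullet> a = p \<bullet> u" using S'(2) hull_inc[of a S'] by auto
      then show "a \<in> P - F" using S'(1) SP \<open>a \<in> S'\<close> puv by (auto simp: F_def)
    qed
    then have "u \<in> convex hull (P - F)"
      using S'(2) uv(1) hull_mono[of S' "P - F"] by blast
    then have "setdist F (convex hull (P - F)) \<le> dist v u"
      using \<open>v \<in> F\<close> by (rule setdist_le_dist[rotated])
    also have "dist v u = norm z" by (simp add: uv(3) dist_norm norm_minus_commute)
    also have "norm z \<le> norm x + norm p"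
      using norm_triangle_ineq4[of x p] by (simp add: p_def)
    also have "\<dots> \<le> m + 2 * e" using np nd mpos e by (simp add: x_def)
    finally show ?thesis using fd by auto
  qed
  show "0 \<le> facial_distance P" using key[of 1] by simp
  have fm: "facial_distance P \<le> m"
  proof (rule field_le_epsilon)
    fix e :: real assume "e > 0"
    then show "facial_distance P \<le> m + e" using key[of "e / 2"] by simp
  qed
  obtain u v where uv: "u \<in> convex hull S" "v \<in> convex hull P" "m *\<^sub>R d = u - v"
    using m(1) by (auto simp: L_def Z_def)
  \<comment> \<open>The exit point still has the direction of \<open>w - q\<close>. Evaluating
    \<open>w - q\<close> on \<open>m *\<^sub>R d = u - v\<close> therefore turns the bound on
    \<open>m\<close> into one on the gap.\<close>
  have "m * norm (w - q) = (w - q) \<bullet> (m *\<^sub>R d)"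
    using nd by (subst (2) wq) (simp add: dot_square_norm)
  also have "\<dots> = (w - q) \<bullet> u - (w - q) \<bullet> v" by (simp add: uv(3) inner_diff_right)
  also have "\<dots> \<le> c - c'"
    using inner_le_convex_hull[OF uv(1) upper] inner_ge_convex_hull[OF uv(2) lower] by linarith
  finally show "facial_distance P * norm (w - q) \<le> c - c'"
    using mult_right_mono[OF fm, of "norm (w - q)"] by simp
qed

text \<open>From the center \<open>q\<close> of a relative ball one can move by \<open>r\<close>
  against \<open>w - q\<close> without leaving the hull. This lowers the functional
  \<open>w - q\<close> by \<open>r * norm (w - q)\<close>, starting from a value at \<open>q\<close>
  that is at most the one at \<open>w\<close>.\<close>

lemma relative_radius_le_gap:
  fixes P :: "'a::euclidean_space set"
  assumes w: "w \<in> convex hull P" and q: "q \<in> convex hull P" and neq: "w \<noteq> q"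
    and lower: "\<And>p. p \<in> P \<Longrightarrow> c' \<le> (w - q) \<bullet> p"
  shows "0 \<le> relative_radius q P" and "relative_radius q P * norm (w - q) \<le> (w - q) \<bullet> w - c'"
proof -
  let ?R = "{r. 0 \<le> r \<and> cball q r \<inter> affine hull P \<subseteq> convex hull P}"
  have npos: "norm (w - q) > 0" using neq by simp
  have bound: "r \<le> ((w - q) \<bullet> w - c') / norm (w - q)" if "r \<in> ?R" for r
  proof -
    define x where "x = q - (r / norm (w - q)) *\<^sub>R (w - q)"
    have qa: "q \<in> affine hull P" and wa: "w \<in> affine hull P"
      using w q convex_hull_subset_affine_hull by auto
    have x_eq: "x = (1 + r / norm (w - q)) *\<^sub>R q + (- (r / norm (w - q))) *\<^sub>R w"
      by (simp add: x_def algebra_simps)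
    have "x \<in> affine hull P"
      unfolding x_eq by (rule mem_affine[OF affine_affine_hull qa wa]) simp
    moreover have "x \<in> cball q r"
      using that npos by (simp add: x_def dist_norm)
    ultimately have "x \<in> convex hull P" using that by auto
    then have "c' \<le> (w - q) \<bullet> x" using inner_ge_convex_hull lower by blast
    also have "(w - q) \<bullet> x = (w - q) \<bullet> q - (r / norm (w - q)) * ((w - q) \<bullet> (w - q))"
      by (simp only: x_def inner_diff_right[of _ q] inner_scaleR_right)
    also have "(w - q) \<bullet> q = (w - q) \<bullet> w - (norm (w - q))\<^sup>2"
      by (simp add: power2_norm_eq_inner inner_diff_right)
    also have "(r / norm (w - q)) * ((w - q) \<bullet> (w - q)) = r * norm (w - q)"
      using npos by (simp add: dot_square_norm power2_eq_square)
    finally have "r * norm (w - q) \<le> (w - q) \<bullet> w - c'"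
      using zero_le_power2[of "norm (w - q)"] by linarith
    then show ?thesis using npos by (simp add: field_simps)
  qed
  have zero: "0 \<in> ?R" using q by auto
  have "bdd_above ?R" using bound by (rule bdd_aboveI)
  then show "0 \<le> relative_radius q P"
    unfolding relative_radius_def using zero by (rule cSup_upper[rotated])
  have "relative_radius q P \<le> ((w - q) \<bullet> w - c') / norm (w - q)"
    unfolding relative_radius_def using zero bound by (intro cSup_least) auto
  then show "relative_radius q P * norm (w - q) \<le> (w - q) \<bullet> w - c'"
    using npos by (simp add: field_simps)
qed

subsection \<open>Linear convergence of the fully corrective method\<close>

text \<open>Along \<open>g + t *\<^sub>R e\<close> the squared norm is a quadratic in
  \<open>t\<close>, minimized at \<open>t = G / N\<close>. The decrease there is
  \<open>G\<^sup>2 / N\<close>, and \<open>1 - x \<le> exp (- x)\<close> gives the exponential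
  form.\<close>

lemma exact_step_contraction:
  fixes g e :: "'a::real_inner"
  assumes gap: "c * norm g \<le> - (g \<bullet> e)" "(norm g)\<^sup>2 \<le> - (g \<bullet> e)"
    and c: "0 \<le> c" and e: "norm e \<le> D"
  shows "\<exists>t\<in>{0..1}. (norm (g + t *\<^sub>R e))\<^sup>2 \<le> exp (- (c\<^sup>2 / D\<^sup>2)) * (norm g)\<^sup>2"
proof -
  define G where "G = - (g \<bullet> e)"
  define N where "N = (norm e)\<^sup>2"
  have expand: "(norm (g + t *\<^sub>R e))\<^sup>2 = (norm g)\<^sup>2 - 2 * t * G + t\<^sup>2 * N" for t
    unfolding G_def N_def power2_norm_eq_inner
    by (simp add: inner_add_left inner_add_right inner_commute[of e g] power2_eq_square algebra_simps)
  have G0: "0 \<le> G" "(norm g)\<^sup>2 \<le> G" using gap(2) zero_le_power2[of "norm g"] unfolding G_def by linarith+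
  have N0: "0 \<le> N" by (simp add: N_def)
  have ND: "N \<le> D\<^sup>2" unfolding N_def by (rule power_mono[OF e]) simp
  show ?thesis
  proof (cases "D = 0 \<or> g = 0")
    case True
    \<comment> \<open>For \<open>D = 0\<close> the quotient \<open>c\<^sup>2 / D\<^sup>2\<close> is
      \<open>0\<close> and the factor is \<open>1\<close>, so standing still is enough.\<close>
    then show ?thesis by (intro bexI[of _ 0]) auto
  next
    case False
    then have D2: "D\<^sup>2 > 0" and g2: "(norm g)\<^sup>2 > 0" by auto
    show ?thesis
    proof (cases "G \<le> N")
      case True
      then have Np: "N > 0" using G0 g2 by linarith
      have "(c * norm g)\<^sup>2 \<le> G\<^sup>2" using gap(1) c by (intro power_mono) (auto simp: G_def)
      then have "c\<^sup>2 * (norm g)\<^sup>2 / D\<^sup>2 \<le> G\<^sup>2 / N"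
        using ND Np by (intro frac_le) (auto simp: power_mult_distrib)
      moreover have "(norm g)\<^sup>2 - 2 * (G / N) * G + (G / N)\<^sup>2 * N = (norm g)\<^sup>2 - G\<^sup>2 / N"
        using Np by (simp add: power2_eq_square field_simps)
      ultimately have "(norm (g + (G / N) *\<^sub>R e))\<^sup>2 \<le> (1 - c\<^sup>2 / D\<^sup>2) * (norm g)\<^sup>2"
        unfolding expand by (simp add: algebra_simps)
      also have "\<dots> \<le> exp (- (c\<^sup>2 / D\<^sup>2)) * (norm g)\<^sup>2"
        using exp_ge_add_one_self[of "- (c\<^sup>2 / D\<^sup>2)"] by (intro mult_right_mono) auto
      finally show ?thesis using True Np G0 by (intro bexI[of _ "G / N"]) auto
    next
      case False
      \<comment> \<open>Here the squared norm of \<open>g + e\<close> is at most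
        \<open>N - G < 0\<close>, so the case cannot arise and any upper bound follows.\<close>
      then have "(norm (g + 1 *\<^sub>R e))\<^sup>2 \<le> 0" unfolding expand using G0 by simp
      also have "0 \<le> exp (- (c\<^sup>2 / D\<^sup>2)) * (norm g)\<^sup>2" by simp
      finally show ?thesis by (intro bexI[of _ 1]) auto
    qed
  qed
qed

lemma fully_corrective_iterate:
  assumes "fully_corrective_stage P q T s \<beta> w" and "t \<le> T"
  shows "\<beta> t \<in> unit_simplex (Suc t)" and "w t = (\<Sum>l\<le>t. \<beta> t l *\<^sub>R s l)"
proof -
  have "\<beta> t \<in> unit_simplex (Suc t) \<and> w t = (\<Sum>l\<le>t. \<beta> t l *\<^sub>R s l)"
  proof (cases t)
    case 0
    have "w 0 = s 0" "\<beta> 0 0 = 1"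
      using assms(1) unfolding fully_corrective_stage_def by blast+
    then show ?thesis by (simp add: 0 unit_simplex_def)
  next
    case (Suc t')
    then have "t \<in> {1..T}" using assms(2) by auto
    then show ?thesis
      using assms(1) unfolding fully_corrective_stage_def is_arg_min_def by blast
  qed
  then show "\<beta> t \<in> unit_simplex (Suc t)" and "w t = (\<Sum>l\<le>t. \<beta> t l *\<^sub>R s l)"
    by auto
qed

lemma fully_corrective_minimal:
  assumes fc: "fully_corrective_stage P q T s \<beta> w" and t: "t \<le> T"
    and c: "c \<in> unit_simplex (Suc t)"
  shows "norm (w t - q) \<le> norm ((\<Sum>l\<le>t. c l *\<^sub>R s l) - q)"
proof (cases t)
  case 0
  have "w 0 = s 0" using fc unfolding fully_corrective_stage_def by blast
  then show ?thesis using c by (simp add: 0 unit_simplex_def)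
next
  case (Suc t')
  then have "t \<in> {1..T}" using t by auto
  with fc have "is_arg_min (\<lambda>c. 1 / 2 * (norm ((\<Sum>l\<le>t. c l *\<^sub>R s l) - q))\<^sup>2)
      (\<lambda>c. c \<in> unit_simplex (Suc t)) (\<beta> t)" and wt: "w t = (\<Sum>l\<le>t. \<beta> t l *\<^sub>R s l)"
    unfolding fully_corrective_stage_def by blast+
  then have "1 / 2 * (norm (w t - q))\<^sup>2 \<le> 1 / 2 * (norm ((\<Sum>l\<le>t. c l *\<^sub>R s l) - q))\<^sup>2"
    using c unfolding is_arg_min_linorder wt by blast
  then show ?thesis by (intro power2_le_imp_le[OF _ norm_ge_zero]) simp
qed

lemma unit_simplex_mix:
  assumes "c \<in> unit_simplex p" "c' \<in> unit_simplex p" "0 \<le> r" "r \<le> 1"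
  shows "(\<lambda>l. (1 - r) * c l + r * c' l) \<in> unit_simplex p"
  using assms by (auto simp: unit_simplex_def sum.distrib sum_distrib_left[symmetric])

lemma unit_simplex_single: "l < p \<Longrightarrow> (\<lambda>j. if j = l then 1 else 0) \<in> unit_simplex p"
  by (auto simp: unit_simplex_def)

text \<open>Membership in \<open>unit_simplex p\<close> leaves the entries from \<open>p\<close> on
  arbitrary, so the added entry has to be set to \<open>0\<close> explicitly.\<close>

lemma unit_simplex_extend:
  "c \<in> unit_simplex p \<Longrightarrow> (\<lambda>j. if j < p then c j else 0) \<in> unit_simplex (Suc p)"
  by (auto simp: unit_simplex_def)

lemma fully_corrective_segment:
  fixes s :: "nat \<Rightarrow> 'a::real_inner"
  assumes fc: "fully_corrective_stage P q T s \<beta> w" and t: "t \<le> T" and l: "l \<le> t"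
    and r: "0 \<le> r" "r \<le> 1"
  shows "norm (w t - q) \<le> norm (((1 - r) *\<^sub>R w t + r *\<^sub>R s l) - q)"
proof -
  let ?c = "\<lambda>j. (1 - r) * \<beta> t j + r * (if j = l then 1 else 0)"
  have "?c \<in> unit_simplex (Suc t)"
    using fully_corrective_iterate(1)[OF fc t] unit_simplex_single[of l "Suc t"] l r
    by (intro unit_simplex_mix) auto
  moreover have "(\<Sum>j\<le>t. ?c j *\<^sub>R s j) = (1 - r) *\<^sub>R w t + r *\<^sub>R s l"
  proof -
    have "?c j *\<^sub>R s j = (1 - r) *\<^sub>R (\<beta> t j *\<^sub>R s j) + (if j = l then r *\<^sub>R s l else 0)" for j
      by (simp add: scaleR_left_distrib)
    then show ?thesis
      using l by (simp add: fully_corrective_iterate(2)[OF fc t] sum.distrib scaleR_sum_right)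
  qed
  ultimately show ?thesis using fully_corrective_minimal[OF fc t] by metis
qed

text \<open>Reoptimizing all weights does at least as well as a plain Frank-Wolfe step of any length
  \<open>r\<close> towards the new atom.\<close>

lemma fully_corrective_next:
  fixes s :: "nat \<Rightarrow> 'a::real_inner"
  assumes fc: "fully_corrective_stage P q T s \<beta> w" and t: "t < T" and r: "0 \<le> r" "r \<le> 1"
  shows "norm (w (Suc t) - q) \<le> norm (((1 - r) *\<^sub>R w t + r *\<^sub>R s (Suc t)) - q)"
proof -
  let ?b = "\<lambda>j. if j < Suc t then \<beta> t j else 0"
  let ?c = "\<lambda>j. (1 - r) * ?b j + r * (if j = Suc t then 1 else 0)"
  have "?c \<in> unit_simplex (Suc (Suc t))"
    using fully_corrective_iterate(1)[OF fc, of t] t r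
    by (intro unit_simplex_mix unit_simplex_extend unit_simplex_single) auto
  moreover have "(\<Sum>j\<le>Suc t. ?c j *\<^sub>R s j) = (1 - r) *\<^sub>R w t + r *\<^sub>R s (Suc t)"
    using fully_corrective_iterate(2)[OF fc, of t] t
    by (simp add: scaleR_sum_right)
  ultimately show ?thesis using fully_corrective_minimal[OF fc, of "Suc t" ?c] t by auto
qed

text \<open>\<open>w t\<close> is the point closest to \<open>q\<close> on each segment towards an
  atom in use, which gives the first-order inequality. The weighted average of these nonnegative
  slacks is \<open>0\<close>, so the slack vanishes wherever the weight is positive.\<close>

lemma fully_corrective_optimality:
  fixes s :: "nat \<Rightarrow> 'a::euclidean_space"
  assumes fc: "fully_corrective_stage P q T s \<beta> w" and t: "t \<le> T" and l: "l \<le> t"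
  shows "(w t - q) \<bullet> w t \<le> (w t - q) \<bullet> s l"
    and "\<beta> t l > 0 \<Longrightarrow> (w t - q) \<bullet> s l = (w t - q) \<bullet> w t"
proof -
  have ge: "(w t - q) \<bullet> w t \<le> (w t - q) \<bullet> s j" if "j \<le> t" for j
  proof -
    have "(q - w t) \<bullet> (s j - w t) \<le> 0"
    proof (rule any_closest_point_dot[of "closed_segment (w t) (s j)"])
      show "\<forall>x\<in>closed_segment (w t) (s j). dist q (w t) \<le> dist q x"
        using fully_corrective_segment[OF fc t that]
        by (auto simp: closed_segment_def dist_norm norm_minus_commute)
    qed auto
    then show ?thesis by (simp add: inner_diff_left inner_diff_right algebra_simps)
  qed
  show "(w t - q) \<bullet> w t \<le> (w t - q) \<bullet> s l" by (rule ge[OF l])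
  note it = fully_corrective_iterate[OF fc t]
  have sum1: "(\<Sum>j\<le>t. \<beta> t j) = 1" and pos: "\<And>j. j \<le> t \<Longrightarrow> 0 \<le> \<beta> t j"
    using it(1) by (auto simp: unit_simplex_def lessThan_Suc_atMost)
  have "(\<Sum>j\<le>t. \<beta> t j * ((w t - q) \<bullet> s j - (w t - q) \<bullet> w t))
      = (w t - q) \<bullet> (\<Sum>j\<le>t. \<beta> t j *\<^sub>R s j) - (\<Sum>j\<le>t. \<beta> t j) * ((w t - q) \<bullet> w t)"
    by (simp add: inner_sum_right right_diff_distrib sum_subtractf sum_distrib_right)
  also have "\<dots> = 0" by (simp add: sum1 it(2)[symmetric])
  finally have "\<forall>j\<in>{..t}. \<beta> t j * ((w t - q) \<bullet> s j - (w t - q) \<bullet> w t) = 0"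
    using ge pos by (subst (asm) sum_nonneg_eq_0_iff) auto
  then show "(w t - q) \<bullet> s l = (w t - q) \<bullet> w t" if "\<beta> t l > 0"
    using l that by (metis atMost_iff eq_iff_diff_eq_0 less_irrefl mult_eq_0_iff)
qed

lemma fully_corrective_step:
  fixes P :: "'a::euclidean_space set"
  assumes fc: "fully_corrective_stage P q T s \<beta> w" and fin: "finite P"
    and sP: "\<And>l. l \<le> T \<Longrightarrow> s l \<in> P" and q: "q \<in> convex hull P" and t: "t < T"
  shows "(norm (w (Suc t) - q))\<^sup>2
    \<le> exp (- (max ((facial_distance P)\<^sup>2) ((relative_radius q P)\<^sup>2) / (diameter (convex hull P))\<^sup>2))
        * (norm (w t - q))\<^sup>2"
proof (cases "w t = q")
  case True
  then show ?thesis using fully_corrective_next[OF fc t, of 0] by simp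
next
  case False
  \<comment> \<open>\<open>S\<close> contains all atoms of positive weight, hence \<open>w t\<close>
    is in its hull. Its values are bounded by the one at \<open>w t\<close>, so the facial-distance
    estimate becomes one for the Frank-Wolfe gap at \<open>w t\<close>.\<close>
  define S where "S = {a \<in> P. (w t - q) \<bullet> a \<le> (w t - q) \<bullet> w t}"
  have tT: "t \<le> T" using t by simp
  note it = fully_corrective_iterate[OF fc tT]
  have sum1: "(\<Sum>j\<le>t. \<beta> t j) = 1" and pos: "\<And>j. j \<le> t \<Longrightarrow> 0 \<le> \<beta> t j"
    using it(1) by (auto simp: unit_simplex_def lessThan_Suc_atMost)
  have w_hull: "w t \<in> convex hull S"
  proof -
    let ?J = "{j. j \<le> t \<and> \<beta> t j > 0}"
    have "(\<Sum>j\<in>?J. \<beta> t j) = (\<Sum>j\<le>t. \<beta> t j)"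
      using pos by (intro sum.mono_neutral_left) (auto simp: less_le)
    moreover have "(\<Sum>j\<in>?J. \<beta> t j *\<^sub>R s j) = w t"
      unfolding it(2) using pos by (intro sum.mono_neutral_left) (auto simp: less_le)
    moreover have "(\<Sum>j\<in>?J. \<beta> t j *\<^sub>R s j) \<in> convex hull S"
      using sum1 calculation(1) pos t fully_corrective_optimality(2)[OF fc tT]
      by (intro convex_sum) (auto intro!: hull_inc simp: S_def sP)
    ultimately show ?thesis by simp
  qed
  have SP: "S \<subseteq> P" by (auto simp: S_def)
  have wP: "w t \<in> convex hull P" using w_hull hull_mono[OF SP] by auto
  have "Suc t \<in> {1..T}" using t by simp
  then have "is_arg_min (\<lambda>a. a \<bullet> (w (Suc t - 1) - q)) (\<lambda>a. a \<in> P) (s (Suc t))"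
    using fc unfolding fully_corrective_stage_def by blast
  then have s_min: "s (Suc t) \<in> P" "\<And>a. a \<in> P \<Longrightarrow> (w t - q) \<bullet> s (Suc t) \<le> (w t - q) \<bullet> a"
    by (auto simp: is_arg_min_linorder inner_commute)
  define c where "c = max (facial_distance P) (relative_radius q P)"
  have fd: "0 \<le> facial_distance P"
    "facial_distance P * norm (w t - q) \<le> (w t - q) \<bullet> w t - (w t - q) \<bullet> s (Suc t)"
    by (rule facial_distance_le_gap[OF fin SP w_hull q False]; use s_min in \<open>auto simp: S_def\<close>)+
  have rr: "0 \<le> relative_radius q P"
    "relative_radius q P * norm (w t - q) \<le> (w t - q) \<bullet> w t - (w t - q) \<bullet> s (Suc t)"
    by (rule relative_radius_le_gap[OF wP q False]; use s_min in auto)+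
  have c0: "0 \<le> c" using fd by (simp add: c_def)
  have c2: "c\<^sup>2 = max ((facial_distance P)\<^sup>2) ((relative_radius q P)\<^sup>2)"
    using fd(1) rr(1) by (auto simp: c_def max_def power_mono intro: antisym)
  have gap: "c * norm (w t - q) \<le> - ((w t - q) \<bullet> (s (Suc t) - w t))"
    using fd(2) rr(2) by (auto simp: c_def max_def inner_diff_right)
  \<comment> \<open>The minimizing atom lies no higher than \<open>q\<close>, so the gap is also at
    least the squared residual. This is what keeps the optimal step length at most
    \<open>1\<close>.\<close>
  have "(w t - q) \<bullet> s (Suc t) \<le> (w t - q) \<bullet> q"
    using q s_min(2) by (rule inner_ge_convex_hull)
  then have gap2: "(norm (w t - q))\<^sup>2 \<le> - ((w t - q) \<bullet> (s (Suc t) - w t))"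
    by (simp add: power2_norm_eq_inner inner_diff_right)
  have "bounded (convex hull P)" using fin by (simp add: finite_imp_bounded bounded_convex_hull)
  then have "norm (s (Suc t) - w t) \<le> diameter (convex hull P)"
    using diameter_bounded_bound wP s_min(1) hull_inc[of _ P] by (metis dist_norm)
  from exact_step_contraction[OF gap gap2 c0 this] obtain r where r: "0 \<le> r" "r \<le> 1"
    "(norm (w t - q + r *\<^sub>R (s (Suc t) - w t)))\<^sup>2
      \<le> exp (- (c\<^sup>2 / (diameter (convex hull P))\<^sup>2)) * (norm (w t - q))\<^sup>2" by auto
  have "(1 - r) *\<^sub>R w t + r *\<^sub>R s (Suc t) - q = w t - q + r *\<^sub>R (s (Suc t) - w t)"
    by (simp add: algebra_simps)
  then have "norm (w (Suc t) - q) \<le> norm (w t - q + r *\<^sub>R (s (Suc t) - w t))"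
    using fully_corrective_next[OF fc t r(1,2)] by metis
  then have "(norm (w (Suc t) - q))\<^sup>2 \<le> (norm (w t - q + r *\<^sub>R (s (Suc t) - w t)))\<^sup>2"
    by (intro power_mono) auto
  with r(3) show ?thesis unfolding c2 by linarith
qed

lemma fully_corrective_linear_convergence:
  fixes P :: "'a::euclidean_space set"
  assumes fc: "fully_corrective_stage P q T s \<beta> w" and fin: "finite P"
    and sP: "\<And>l. l \<le> T \<Longrightarrow> s l \<in> P" and q: "q \<in> convex hull P"
    and \<delta>: "\<delta> = max ((facial_distance P)\<^sup>2) ((relative_radius q P)\<^sup>2)"
    and D: "D = diameter (convex hull P)"
  shows "norm (w T - q) \<le> norm (w 0 - q) * exp (- (real T * \<delta> / (8 * D\<^sup>2)))"
proof -
  have "t \<le> T \<Longrightarrow> (norm (w t - q))\<^sup>2 \<le> exp (- (real t * (\<delta> / D\<^sup>2))) * (norm (w 0 - q))\<^sup>2" for t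
  proof (induction t)
    case (Suc t)
    have "(norm (w (Suc t) - q))\<^sup>2 \<le> exp (- (\<delta> / D\<^sup>2)) * (norm (w t - q))\<^sup>2"
      using fully_corrective_step[OF fc fin sP q] Suc.prems by (simp add: \<delta> D)
    also have "\<dots> \<le> exp (- (\<delta> / D\<^sup>2)) * (exp (- (real t * (\<delta> / D\<^sup>2))) * (norm (w 0 - q))\<^sup>2)"
      using Suc by (intro mult_left_mono) auto
    also have "\<dots> = exp (- (real (Suc t) * (\<delta> / D\<^sup>2))) * (norm (w 0 - q))\<^sup>2"
      by (simp add: mult.assoc[symmetric] mult_exp_exp distrib_right add_divide_distrib)
    finally show ?case .
  qed simp
  from this[of T] have "(norm (w T - q))\<^sup>2 \<le> exp (- (real T * (\<delta> / D\<^sup>2))) * (norm (w 0 - q))\<^sup>2"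
    by simp
  \<comment> \<open>Taking the root of the recursion would leave the exponent
    \<open>T * \<delta> / (2 * D\<^sup>2)\<close>; it is weakened here to the constant
    \<open>8\<close>.\<close>
  also have "\<dots> \<le> exp (2 * - (real T * \<delta> / (8 * D\<^sup>2))) * (norm (w 0 - q))\<^sup>2"
  proof -
    define X where "X = real T * (\<delta> / D\<^sup>2)"
    have "0 \<le> \<delta>" by (simp add: \<delta> max.coboundedI1)
    then have "0 \<le> X" by (simp add: X_def)
    moreover have "2 * - (real T * \<delta> / (8 * D\<^sup>2)) = - (X / 4)" by (simp add: X_def mult_ac)
    ultimately show ?thesis unfolding X_def[symmetric] by (intro mult_right_mono) auto
  qed
  also have "\<dots> = (norm (w 0 - q) * exp (- (real T * \<delta> / (8 * D\<^sup>2))))\<^sup>2"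
    by (simp only: power_mult_distrib exp_double) (simp only: mult.commute)
  finally show ?thesis by (rule power2_le_imp_le) simp
qed

subsection \<open>Biconjugates and nonconvexity\<close>

lemma biconjugate_le:
  assumes "proper f"
  shows "biconjugate f x \<le> f x"
  unfolding biconjugate_def conjugate_def[of "conjugate f"]
proof (rule SUP_least)
  fix u
  have "ereal (u \<bullet> x) - f x \<le> conjugate f u"
    unfolding conjugate_def by (rule SUP_upper) simp
  then show "ereal (x \<bullet> u) - conjugate f u \<le> f x"
    using assms unfolding proper_def
    by (cases "f x"; cases "conjugate f u") (auto simp: inner_commute dest: spec[of _ x])
qed

text \<open>The minorant bounds the conjugate at slope \<open>a\<close> by \<open>- c\<close>, and
  this slope enters the outer supremum. It keeps the biconjugate above
  \<open>-\<infinity>\<close>.\<close>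

lemma biconjugate_ge_affine:
  assumes "\<And>x. ereal (a \<bullet> x + c) \<le> f x"
  shows "ereal (a \<bullet> x + c) \<le> biconjugate f x"
proof -
  have "conjugate f a \<le> ereal (- c)"
    unfolding conjugate_def
  proof (rule SUP_least)
    fix y show "ereal (a \<bullet> y) - f y \<le> ereal (- c)"
      using assms[of y] by (cases "f y") auto
  qed
  then have "ereal (a \<bullet> x + c) \<le> ereal (x \<bullet> a) - conjugate f a"
    by (cases "conjugate f a") (auto simp: inner_commute)
  also have "\<dots> \<le> biconjugate f x"
    unfolding biconjugate_def conjugate_def[of "conjugate f"] by (rule SUP_upper) simp
  finally show ?thesis .
qed

lemma proper_edom_real:
  "proper f \<Longrightarrow> x \<in> edom f \<Longrightarrow> ereal (real_of_ereal (f x)) = f x"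
  unfolding proper_def edom_def by (cases "f x") (auto dest: spec[of _ x])

lemma biconjugate_real:
  assumes "proper f" "has_affine_minorant f" "x \<in> edom f"
  shows "ereal (real_of_ereal (biconjugate f x)) = biconjugate f x"
proof -
  have "biconjugate f x < \<infinity>"
    using biconjugate_le[OF assms(1), of x] assms(3) by (auto simp: edom_def)
  moreover obtain a c where "\<And>x. ereal (a \<bullet> x + c) \<le> f x"
    using assms(2) unfolding has_affine_minorant_def by blast
  then have "ereal (a \<bullet> x + c) \<le> biconjugate f x" by (rule biconjugate_ge_affine)
  ultimately show ?thesis by (cases "biconjugate f x") auto
qed

text \<open>The definition uses index sets \<open>{..<p}\<close>; a bijection transfers it to any
  finite \<open>J\<close>. The values on the domain are finite, so their sum can be moved across the
  inequality.\<close>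

lemma nonconvexity_upper:
  assumes f: "proper f" and J: "finite J" and c: "\<And>j. j \<in> J \<Longrightarrow> 0 \<le> c j" "(\<Sum>j\<in>J. c j) = 1"
    and x: "\<And>j. j \<in> J \<Longrightarrow> x j \<in> edom f"
  shows "f (\<Sum>j\<in>J. c j *\<^sub>R x j) \<le> ereal (\<Sum>j\<in>J. c j * real_of_ereal (f (x j))) + nonconvexity f"
proof -
  obtain h where h: "bij_betw h {..<card J} J"
    using ex_bij_betw_nat_finite[OF J] by (auto simp: atLeast0LessThan)
  have hJ: "h j \<in> J" if "j < card J" for j
    using h that by (auto simp: bij_betw_def)
  have "(\<Sum>j<card J. c (h j)) = 1"
    using sum.reindex_bij_betw[OF h, of c] c(2) by simp
  then have mem: "(card J, x \<circ> h, c \<circ> h) \<in> {(p, x, c). (\<forall>j<p. x j \<in> edom f) \<and> c \<in> unit_simplex p}"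
    using hJ c(1) x by (auto simp: unit_simplex_def)
  have "f (\<Sum>j<card J. c (h j) *\<^sub>R x (h j)) - (\<Sum>j<card J. ereal (c (h j)) * f (x (h j)))
      \<le> nonconvexity f"
    unfolding nonconvexity_def by (rule order_trans[OF _ SUP_upper[OF mem]]) simp
  moreover have "(\<Sum>j<card J. c (h j) *\<^sub>R x (h j)) = (\<Sum>j\<in>J. c j *\<^sub>R x j)"
    by (rule sum.reindex_bij_betw[OF h])
  moreover have "(\<Sum>j<card J. ereal (c (h j)) * f (x (h j))) = (\<Sum>j\<in>J. ereal (c j) * f (x j))"
    by (rule sum.reindex_bij_betw[OF h])
  moreover have "(\<Sum>j\<in>J. ereal (c j) * f (x j)) = ereal (\<Sum>j\<in>J. c j * real_of_ereal (f (x j)))"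
  proof -
    have "ereal (c j) * f (x j) = ereal (c j * real_of_ereal (f (x j)))" if "j \<in> J" for j
      using proper_edom_real[OF f x[OF that]] by (metis times_ereal.simps(1))
    then show ?thesis by simp
  qed
  ultimately have "f (\<Sum>j\<in>J. c j *\<^sub>R x j) - ereal (\<Sum>j\<in>J. c j * real_of_ereal (f (x j)))
      \<le> nonconvexity f" by simp
  then show ?thesis
    by (cases "f (\<Sum>j\<in>J. c j *\<^sub>R x j)"; cases "nonconvexity f") auto
qed

lemma nonconvexity_nonneg:
  assumes "proper f"
  shows "0 \<le> nonconvexity f"
proof -
  obtain x where x: "x \<in> edom f" using assms by (auto simp: proper_def)
  have "f x \<le> f x + nonconvexity f"
    using nonconvexity_upper[OF assms, of "{x}" "\<lambda>_. 1" "\<lambda>x. x"] x proper_edom_real[OF assms x]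
    by auto
  then show ?thesis
    using proper_edom_real[OF assms x] by (cases "f x"; cases "nonconvexity f") auto
qed

subsection \<open>The Frank-Wolfe stage\<close>

text \<open>\<open>norm (sup u 0)\<close> is the distance of \<open>u\<close> to the nonpositive
  orthant, and \<open>x - sup x 0\<close> is a point of this orthant. The estimate serves as
  quadratic upper model in the Frank-Wolfe stage and as perturbation bound for the constraint
  residual.\<close>

lemma norm_sup_add_le_vec:
  fixes x h :: "real ^ 'm"
  shows "norm (sup (x + h) 0) \<le> norm (sup x 0 + h)"
  by (rule norm_le_componentwise_cart) (auto simp: sup_vec_def sup_real_def max_def)

lemma norm_sup_add_le:
  fixes x h :: "real \<times> (real ^ 'm)"
  shows "norm (sup (x + h) 0) \<le> norm (sup x 0 + h)"
proof -
  have "norm (sup (fst x + fst h) 0) \<le> norm (sup (fst x) 0 + fst h)"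
    by (auto simp: sup_real_def max_def)
  then have "(norm (sup (fst x + fst h) 0))\<^sup>2 \<le> (norm (sup (fst x) 0 + fst h))\<^sup>2"
    by (rule power_mono) simp
  moreover have "(norm (sup (snd x + snd h) 0))\<^sup>2 \<le> (norm (sup (snd x) 0 + snd h))\<^sup>2"
    by (rule power_mono[OF norm_sup_add_le_vec]) simp
  ultimately have "(norm (sup (fst x + fst h) 0))\<^sup>2 + (norm (sup (snd x + snd h) 0))\<^sup>2
      \<le> (norm (sup (fst x) 0 + fst h))\<^sup>2 + (norm (sup (snd x) 0 + snd h))\<^sup>2"
    by (rule add_mono)
  then show ?thesis by (simp add: norm_prod_def)
qed

text \<open>Positive and negative parts have disjoint supports.\<close>

lemma inner_sup_self:
  fixes x :: "real \<times> (real ^ 'm)"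
  shows "sup x 0 \<bullet> x = (norm (sup x 0))\<^sup>2"
proof -
  have m: "max t 0 * t = max t 0 * max t 0" for t :: real by (auto simp: max_def)
  show ?thesis
    unfolding power2_norm_eq_inner inner_prod_def
    by (auto simp: inner_vec_def sup_vec_def sup_real_def m intro!: sum.cong)
qed

lemma norm_plus_eq_norm_sup: "norm_plus x = norm (sup x 0)"
  by (simp add: norm_plus_def norm_vec_def L2_set_def sup_vec_def sup_real_def)

text \<open>The first step has length \<open>1\<close> and erases \<open>G 0\<close>, so the
  induction starts at \<open>G 1\<close>. It carries the slightly sharper bound
  \<open>4 * D / (K + 2)\<close>, which is preserved because
  \<open>(x - 1) * (x + 1) \<le> x\<^sup>2\<close> for \<open>x = k + 3\<close>.\<close>

lemma frank_wolfe_recurrence: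
  fixes G :: "nat \<Rightarrow> real"
  assumes step: "\<And>k. k < K \<Longrightarrow> G (Suc k) \<le> (1 - 2 / (real k + 2)) * G k + (2 / (real k + 2))\<^sup>2 * D"
    and D: "0 \<le> D" and K: "1 \<le> K"
  shows "G K \<le> 4 * D / (real K + 1)"
proof -
  have bound: "G (Suc k) \<le> 4 * D / (real k + 3)" if "k < K" for k
    using that
  proof (induction k)
    case 0
    then show ?case using step[of 0] D by (simp add: field_simps)
  next
    case (Suc k)
    have "G (Suc (Suc k)) \<le> (1 - 2 / (real k + 3)) * G (Suc k) + (2 / (real k + 3))\<^sup>2 * D"
      using step[OF Suc.prems] by (simp add: algebra_simps)
    also have "\<dots> \<le> (1 - 2 / (real k + 3)) * (4 * D / (real k + 3)) + (2 / (real k + 3))\<^sup>2 * D"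
      using Suc by (intro add_right_mono mult_left_mono) (auto simp: field_simps)
    also have "\<dots> = 4 * D * ((real k + 2) / (real k + 3)\<^sup>2)"
    proof -
      have "(1 - 2 / x) * (4 * D / x) + (2 / x)\<^sup>2 * D = 4 * D * ((x - 1) / x\<^sup>2)" if "x > 0" for x
        using that by (simp add: field_simps power2_eq_square)
      from this[of "real k + 3"] show ?thesis by simp
    qed
    also have "\<dots> \<le> 4 * D * (1 / (real k + 4))"
    proof (intro mult_left_mono)
      have "(real k + 2) * (real k + 4) \<le> (real k + 3)\<^sup>2"
        by (simp add: power2_eq_square algebra_simps)
      then have "real k + 2 \<le> (real k + 3)\<^sup>2 / (real k + 4)"
        by (intro mult_imp_le_div_pos) auto
      then show "(real k + 2) / (real k + 3)\<^sup>2 \<le> 1 / (real k + 4)"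
        by (intro mult_imp_div_pos_le) auto
    qed (use D in auto)
    finally show ?case by (simp add: algebra_simps)
  qed
  obtain k where k: "K = Suc k" using K by (cases K) auto
  have "G K \<le> 4 * D / (real k + 3)" using bound k by simp
  also have "\<dots> \<le> 4 * D / (real K + 1)" using D k by (intro divide_left_mono) auto
  finally show ?thesis .
qed

text \<open>The short step minimizes the quadratic model on \<open>[0, 1]\<close>, hence beats the
  open-loop step \<open>2 / (k + 2)\<close>; one recursion then serves both rules.\<close>

lemma short_step_optimal:
  fixes g N :: real
  assumes "0 \<le> g" "0 < N" "0 \<le> r" "r \<le> 1"
  shows "(min 1 (g / N))\<^sup>2 * N - 2 * min 1 (g / N) * g \<le> r\<^sup>2 * N - 2 * r * g"
proof (cases "g \<le> N")
  case True
  then have m: "min 1 (g / N) = g / N" using assms by (simp add: min_def field_simps)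
  have "0 \<le> (r * N - g)\<^sup>2 / N" using assms by simp
  also have "\<dots> = r\<^sup>2 * N - 2 * r * g - ((g / N)\<^sup>2 * N - 2 * (g / N) * g)"
    using assms by (simp add: field_simps power2_eq_square)
  finally show ?thesis unfolding m by simp
next
  case False
  then have m: "min 1 (g / N) = 1" using assms by (simp add: min_def field_simps)
  have "N * (1 + r) \<le> N * 2" using assms by (intro mult_left_mono) auto
  then have "N * (1 + r) \<le> 2 * g" using False by linarith
  then have "0 \<le> (1 - r) * (2 * g - N * (1 + r))" using assms by (intro mult_nonneg_nonneg) auto
  then show ?thesis unfolding m by (simp add: algebra_simps power2_eq_square)
qed

section \<open>The image set \<open>C_set f A\<close> and linear minimization over it\<close>

lemma sum_block:
  fixes blk :: "'d::finite \<Rightarrow> 'n::finite"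
  shows "(\<Sum>i\<in>UNIV. block blk i x) = x"
  by (simp add: vec_eq_iff block_def)

lemma matrix_vector_mult_sum_right:
  fixes A :: "real ^ 'd ^ 'm"
  shows "A *v (\<Sum>i\<in>J. x i) = (\<Sum>i\<in>J. A *v x i)"
  by (rule linear_sum[OF matrix_vector_mul_linear])

lemma aggregate_in_C_set:
  assumes "\<And>i. y i \<in> edom (f i)" "\<And>i. f i (y i) = biconjugate (f i) (y i)"
  shows "aggregate f A y \<in> C_set f A"
  unfolding aggregate_def C_set_def C_block_def
  using assms by (fastforce intro: hull_inc)

text \<open>The convexified value is an infimum, so a feasible point is taken with slack
  \<open>e\<close>. With convex domains the hull adds no points, and \<open>real_of_ereal\<close> is
  faithful there.\<close>

lemma C_set_near_feasible:
  fixes f :: "'n::finite \<Rightarrow> real ^ 'd::finite \<Rightarrow> ereal"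
  assumes proper: "\<And>i. proper (f i)" and minorant: "\<And>i. has_affine_minorant (f i)"
    and convex_dom: "\<And>i. convex (edom (f i))"
    and val: "convexified_value blk f A b = ereal v" and e: "0 < e"
  shows "\<exists>c \<in> C_set f A. fst c \<le> v + e \<and> snd c \<le> b"
proof -
  have "convexified_value blk f A b < ereal (v + e)" using val e by simp
  then obtain x where x: "A *v x \<le> b" "\<And>i. block blk i x \<in> convex hull edom (f i)"
    "(\<Sum>i\<in>UNIV. biconjugate (f i) (block blk i x)) < ereal (v + e)"
    unfolding convexified_value_def INF_less_iff by blast
  define c where "c = (\<lambda>i. (real_of_ereal (biconjugate (f i) (block blk i x)), A *v block blk i x))"
  have "(\<Sum>i\<in>UNIV. c i) \<in> C_set f A"
    using x(2) by (auto simp: C_set_def C_block_def c_def)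
  moreover have "ereal (fst (\<Sum>i\<in>UNIV. c i)) = (\<Sum>i\<in>UNIV. biconjugate (f i) (block blk i x))"
  proof -
    have "block blk i x \<in> edom (f i)" for i using x(2)[of i] convex_dom by (simp add: hull_same)
    then show ?thesis
      by (simp add: c_def fst_sum biconjugate_real[OF proper minorant] flip: sum_ereal)
  qed
  moreover have "snd (\<Sum>i\<in>UNIV. c i) = A *v x"
    by (simp add: c_def snd_sum sum_block flip: matrix_vector_mult_sum_right)
  ultimately show ?thesis using x(1,3) by (metis ereal_less_eq(3) less_imp_le)
qed

text \<open>A linear functional is minimized over a Minkowski sum block by block; finiteness of the
  biconjugates turns the extended-valued minimality into one of reals.\<close>

lemma frank_wolfe_linear_minimal:
  fixes f :: "'n::finite \<Rightarrow> real ^ 'd::finite \<Rightarrow> ereal"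
  assumes proper: "\<And>i. proper (f i)" and minorant: "\<And>i. has_affine_minorant (f i)"
    and convex_dom: "\<And>i. convex (edom (f i))"
    and fw: "frank_wolfe_stage f A zstar K y0 y \<eta> z" and k: "k < K" and c: "c \<in> C_set f A"
  shows "sup (z k - zstar) 0 \<bullet> aggregate f A (y k) \<le> sup (z k - zstar) 0 \<bullet> c"
proof -
  define v where "v = sup (z k - zstar) 0"
  have min: "is_arg_min (\<lambda>x. ereal (fst v) * biconjugate (f i) x + ereal (snd v \<bullet> (A *v x)))
      (\<lambda>x. x \<in> convex hull edom (f i)) (y k i)"
    and yk: "y k i \<in> edom (f i)" "f i (y k i) = biconjugate (f i) (y k i)" for i
    using fw k unfolding frank_wolfe_stage_def Let_def v_def by blast+
  obtain d where d: "c = (\<Sum>i\<in>UNIV. d i)" "\<And>i. d i \<in> C_block f A i"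
    using c by (auto simp: C_set_def)
  have "v \<bullet> (real_of_ereal (f i (y k i)), A *v y k i) \<le> v \<bullet> d i" for i
  proof -
    obtain x where x: "d i = (real_of_ereal (biconjugate (f i) x), A *v x)" "x \<in> convex hull edom (f i)"
      using d(2)[of i] by (auto simp: C_block_def)
    have "x \<in> edom (f i)" using x(2) convex_dom by (simp add: hull_same)
    then obtain r r' where r: "biconjugate (f i) x = ereal r" "biconjugate (f i) (y k i) = ereal r'"
      using biconjugate_real[OF proper minorant] yk(1) by metis
    have "ereal (fst v) * biconjugate (f i) (y k i) + ereal (snd v \<bullet> (A *v y k i))
        \<le> ereal (fst v) * biconjugate (f i) x + ereal (snd v \<bullet> (A *v x))"
      using min[of i] x(2) unfolding is_arg_min_linorder by blast
    then show ?thesis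
      by (simp add: inner_prod_def x(1) yk(2) r)
  qed
  then show ?thesis
    unfolding v_def[symmetric] aggregate_def d(1) inner_sum_right by (intro sum_mono)
qed

lemma inner_mono_right:
  fixes v x y :: "real \<times> (real ^ 'm)"
  assumes "0 \<le> fst v" "\<And>j. 0 \<le> snd v $ j" "fst x \<le> fst y" "snd x \<le> snd y"
  shows "v \<bullet> x \<le> v \<bullet> y"
  using assms unfolding inner_prod_def inner_vec_def less_eq_vec_def
  by (intro add_mono sum_mono) (auto intro: mult_left_mono)

lemma frank_wolfe_convergence:
  fixes f :: "'n::finite \<Rightarrow> real ^ 'd::finite \<Rightarrow> ereal" and A :: "real ^ 'd ^ 'm::finite"
  assumes proper: "\<And>i. proper (f i)" and minorant: "\<And>i. has_affine_minorant (f i)"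
    and convex_dom: "\<And>i. convex (edom (f i))"
    and val: "convexified_value blk f A b = ereal v"
    and K: "1 \<le> K"
    and fw: "frank_wolfe_stage f A (v, b) K y0 y \<eta> z"
    and D: "D_C f A = ereal D"
  shows "norm (sup (z K - (v, b)) 0) \<le> 2 * D / sqrt (real K + 1)"
proof -
  define p where "p = (\<lambda>k. sup (z k - (v, b)) 0)"
  define s where "s = (\<lambda>k. aggregate f A (y k))"
  note fw' = fw[unfolded frank_wolfe_stage_def Let_def, folded p_def s_def]
  have z_Suc: "z (Suc k) = (1 - \<eta> k) *\<^sub>R z k + \<eta> k *\<^sub>R s k" if "k < K" for k
    using fw' that unfolding s_def by blast
  have rule: "open_loop_steps K \<eta> \<or> short_steps K p z s \<eta>"
    using fw' unfolding p_def s_def by blast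
  have s_mem: "s k \<in> C_set f A" if "k < K" for k
    unfolding s_def using fw' that by (intro aggregate_in_C_set) blast+
  have z0_mem: "z 0 \<in> C_set f A"
  proof -
    have "z 0 = aggregate f A y0" using fw' by blast
    moreover have "aggregate f A y0 \<in> C_set f A"
      using fw' by (intro aggregate_in_C_set) blast+
    ultimately show ?thesis by simp
  qed
  have diam: "norm (c - c') \<le> D" if "c \<in> C_set f A" "c' \<in> C_set f A" for c c'
  proof -
    have "ereal (norm (c - c')) \<le> D_C f A"
      unfolding D_C_def using that by (intro SUP_upper2[of c] SUP_upper2[of c']) auto
    then show ?thesis by (simp add: D)
  qed
  have D0: "0 \<le> D" using diam[OF z0_mem z0_mem] by simp
  have p0: "0 \<le> fst (p k)" "0 \<le> snd (p k) $ j" for k j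
    by (simp_all add: p_def sup_vec_def)
  \<comment> \<open>\<open>p k\<close> is nonnegative and \<open>C\<close> contains points almost
    below the target, so the minimizer \<open>s k\<close> scores no higher than the target. Against
    the target, \<open>z k\<close> scores exactly \<open>(norm (p k))\<^sup>2\<close>.\<close>
  have descent: "(norm (p k))\<^sup>2 \<le> p k \<bullet> (z k - s k)" if "k < K" for k
  proof -
    have "p k \<bullet> s k \<le> p k \<bullet> (v, b)"
    proof (rule field_le_epsilon)
      fix e :: real assume "0 < e"
      \<comment> \<open>Scaled so that \<open>fst (p k) * e' \<le> e\<close>; the summand
        \<open>1\<close> covers \<open>fst (p k) = 0\<close>.\<close>
      define e' where "e' = e / (fst (p k) + 1)"
      have pe: "0 < e'" "fst (p k) * e' \<le> e"
        using \<open>0 < e\<close> p0[of k] by (auto simp: e'_def field_simps)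
      obtain c where c: "c \<in> C_set f A" "fst c \<le> v + e'" "snd c \<le> b"
        using C_set_near_feasible[OF proper minorant convex_dom val pe(1)] by blast
      have "p k \<bullet> s k \<le> p k \<bullet> c"
        unfolding p_def s_def
        by (rule frank_wolfe_linear_minimal[OF proper minorant convex_dom fw that c(1)])
      also have "\<dots> \<le> p k \<bullet> (v + e', b)" using c p0 by (intro inner_mono_right) auto
      also have "\<dots> \<le> p k \<bullet> (v, b) + e" using pe(2) by (simp add: inner_prod_def algebra_simps)
      finally show "p k \<bullet> s k \<le> p k \<bullet> (v, b) + e" .
    qed
    moreover have "p k \<bullet> (z k - (v, b)) = (norm (p k))\<^sup>2" unfolding p_def by (rule inner_sup_self)
    ultimately show ?thesis by (simp add: inner_diff_right)
  qed
  have \<eta>: "0 \<le> \<eta> k \<and> \<eta> k \<le> 1" if "k < K" for k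
  proof -
    have "0 \<le> p k \<bullet> (z k - s k)" using descent[OF that] zero_le_power2 order_trans by blast
    from rule show ?thesis
    proof
      assume "open_loop_steps K \<eta>"
      then show ?thesis using that by (simp add: open_loop_steps_def)
    next
      assume "short_steps K p z s \<eta>"
      then show ?thesis
        using that \<open>0 \<le> p k \<bullet> (z k - s k)\<close> unfolding short_steps_def by (cases "z k = s k") auto
    qed
  qed
  \<comment> \<open>The iterates are convex combinations of points of \<open>C\<close>. Carrying the
    distance bound through the induction avoids placing them in \<open>C\<close> itself.\<close>
  have z_diam: "\<forall>c\<in>C_set f A. norm (z k - c) \<le> D" if "k \<le> K" for k
    using that
  proof (induction k)
    case 0
    then show ?case using diam z0_mem by blast
  next
    case (Suc k)
    show ?case
    proof
      fix c assume c: "c \<in> C_set f A"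
      have "z (Suc k) - c = (1 - \<eta> k) *\<^sub>R (z k - c) + \<eta> k *\<^sub>R (s k - c)"
        using Suc.prems by (simp add: z_Suc algebra_simps)
      also have "norm \<dots> \<le> (1 - \<eta> k) * norm (z k - c) + \<eta> k * norm (s k - c)"
        using \<eta>[of k] Suc.prems by (intro norm_triangle_le) auto
      also have "\<dots> \<le> (1 - \<eta> k) * D + \<eta> k * D"
        using \<eta>[of k] Suc c s_mem[of k] diam by (intro add_mono mult_left_mono) auto
      finally show "norm (z (Suc k) - c) \<le> D" by (simp add: algebra_simps)
    qed
  qed
  have "(norm (p (Suc k)))\<^sup>2 \<le> (1 - 2 / (real k + 2)) * (norm (p k))\<^sup>2 + (2 / (real k + 2))\<^sup>2 * D\<^sup>2"
    if k: "k < K" for k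
  proof -
    define r where "r = 2 / (real k + 2)"
    define g where "g = p k \<bullet> (z k - s k)"
    define N where "N = (norm (z k - s k))\<^sup>2"
    have r: "0 \<le> r" "r \<le> 1" by (auto simp: r_def)
    have g: "(norm (p k))\<^sup>2 \<le> g" "0 \<le> g"
      using descent[OF k] zero_le_power2[of "norm (p k)"] unfolding g_def by linarith+
    have N: "N \<le> D\<^sup>2" unfolding N_def using z_diam[of k] s_mem[OF k] k by (intro power_mono) auto
    have "z (Suc k) - (v, b) = (z k - (v, b)) + \<eta> k *\<^sub>R (s k - z k)"
      using k by (simp add: z_Suc algebra_simps)
    then have "norm (p (Suc k)) \<le> norm (p k + \<eta> k *\<^sub>R (s k - z k))"
      unfolding p_def using norm_sup_add_le by metis
    then have "(norm (p (Suc k)))\<^sup>2 \<le> (norm (p k + \<eta> k *\<^sub>R (s k - z k)))\<^sup>2"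
      by (rule power_mono) simp
    also have "\<dots> = (norm (p k))\<^sup>2 + ((\<eta> k)\<^sup>2 * N - 2 * \<eta> k * g)"
    proof -
      have "p k + \<eta> k *\<^sub>R (s k - z k) = p k - \<eta> k *\<^sub>R (z k - s k)" by (simp add: algebra_simps)
      moreover have "(norm (a - t *\<^sub>R c))\<^sup>2 = (norm a)\<^sup>2 + (t\<^sup>2 * (norm c)\<^sup>2 - 2 * t * (a \<bullet> c))"
        for a c :: "real \<times> (real ^ 'm)" and t :: real
        unfolding power2_norm_eq_inner
        by (simp add: inner_diff_left inner_diff_right inner_commute[of c a] power2_eq_square algebra_simps)
      ultimately show ?thesis by (simp add: g_def N_def)
    qed
    also have "(\<eta> k)\<^sup>2 * N - 2 * \<eta> k * g \<le> r\<^sup>2 * N - 2 * r * g"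
    proof (cases "open_loop_steps K \<eta>")
      case True
      then show ?thesis using k by (simp add: open_loop_steps_def r_def)
    next
      case False
      then have short: "short_steps K p z s \<eta>" using rule by blast
      show ?thesis
      proof (cases "z k = s k")
        case True
        then show ?thesis by (simp add: g_def N_def)
      next
        case False
        then have "\<eta> k = min 1 (g / N)" using short k by (simp add: short_steps_def g_def N_def)
        moreover have "N > 0" using False by (simp add: N_def)
        ultimately show ?thesis using short_step_optimal[OF g(2) _ r] by simp
      qed
    qed
    \<comment> \<open>Half of the linear decrease \<open>2 * r * g\<close> suffices: it yields the
      contraction factor \<open>1 - r\<close> required by the recursion.\<close>
    also have "r\<^sup>2 * N - 2 * r * g \<le> r\<^sup>2 * D\<^sup>2 - r * (norm (p k))\<^sup>2"
    proof -
      have "r\<^sup>2 * N \<le> r\<^sup>2 * D\<^sup>2" using N by (intro mult_left_mono) auto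
      moreover have "r * (norm (p k))\<^sup>2 \<le> r * g" using g r by (intro mult_left_mono) auto
      moreover have "0 \<le> r * g" using g r by simp
      ultimately show ?thesis by linarith
    qed
    finally show ?thesis by (simp add: r_def algebra_simps)
  qed
  then have "(norm (p K))\<^sup>2 \<le> 4 * D\<^sup>2 / (real K + 1)"
    using K by (intro frank_wolfe_recurrence) auto
  also have "\<dots> = (2 * D / sqrt (real K + 1))\<^sup>2" by (simp add: power_divide power_mult_distrib)
  finally have "norm (p K) \<le> 2 * D / sqrt (real K + 1)"
    by (rule power2_le_imp_le) (use D0 in simp)
  then show ?thesis by (simp only: p_def)
qed

subsection \<open>From the trimmed combination to block-wise averages\<close>

text \<open>Cauchy-Schwarz against the all-ones vector; the source of the factor
  \<open>sqrt n\<close> in both error terms.\<close>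

lemma sum_abs_le_norm_vec:
  fixes x :: "real ^ 'n::finite"
  shows "(\<Sum>i\<in>UNIV. \<bar>x $ i\<bar>) \<le> sqrt (real CARD('n)) * norm x"
  using L2_set_mult_ineq[of "\<lambda>_. 1" "\<lambda>i. x $ i" "UNIV :: 'n set"]
  by (simp add: norm_vec_def L2_set_def)

text \<open>With \<open>u i\<close> the normalized average of block \<open>i\<close>, the
  combination equals the sum of \<open>B i *\<^sub>R u i\<close>. Replacing \<open>B i\<close> by
  \<open>1 / n\<close> costs \<open>\<bar>B i - 1 / n\<bar> * M\<close> per block, before scaling by
  \<open>n\<close>.\<close>

lemma reweighting_error:
  fixes v :: "'l \<Rightarrow> 'a::real_normed_vector" and g :: "'l \<Rightarrow> 'n::finite" and c :: "'l \<Rightarrow> real"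
  assumes B_def: "B = (\<lambda>i. \<Sum>l\<in>{l \<in> J. g l = i}. c l)"
    and J: "finite J" and c: "\<And>l. l \<in> J \<Longrightarrow> 0 \<le> c l" and B: "\<And>i. 0 < B i"
    and v: "\<And>l. l \<in> J \<Longrightarrow> norm (v l) \<le> M"
  shows "norm ((\<Sum>i\<in>UNIV. \<Sum>l\<in>{l \<in> J. g l = i}. (c l / B i) *\<^sub>R v l)
            - real CARD('n) *\<^sub>R (\<Sum>l\<in>J. c l *\<^sub>R v l))
     \<le> real CARD('n) * sqrt (real CARD('n)) * M * norm ((\<chi> i. B i - 1 / real CARD('n)) :: real ^ 'n)"
proof -
  let ?n = "real CARD('n)"
  define u where "u = (\<lambda>i. \<Sum>l\<in>{l \<in> J. g l = i}. (c l / B i) *\<^sub>R v l)"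
  have u: "norm (u i) \<le> M" for i
  proof -
    have "norm (u i) \<le> (\<Sum>l\<in>{l \<in> J. g l = i}. (c l / B i) * M)"
      unfolding u_def using B[of i] c v
      by (intro sum_norm_le) (auto intro!: mult_left_mono divide_right_mono)
    also have "\<dots> = (B i / B i) * M"
      unfolding sum_distrib_right[symmetric] sum_divide_distrib[symmetric] by (simp add: B_def)
    finally show ?thesis using B[of i] by simp
  qed
  have Bu: "(\<Sum>l\<in>{l \<in> J. g l = i}. c l *\<^sub>R v l) = B i *\<^sub>R u i" for i
    using B[of i] by (simp add: u_def scaleR_sum_right)
  have "(\<Sum>l\<in>J. c l *\<^sub>R v l) = (\<Sum>i\<in>UNIV. B i *\<^sub>R u i)"
    unfolding Bu[symmetric] using J by (subst sum.group) auto
  then have "(\<Sum>i\<in>UNIV. u i) - ?n *\<^sub>R (\<Sum>l\<in>J. c l *\<^sub>R v l)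
      = (\<Sum>i\<in>UNIV. (?n * (1 / ?n - B i)) *\<^sub>R u i)"
    by (simp add: scaleR_sum_right algebra_simps sum_subtractf)
  also have "norm \<dots> \<le> (\<Sum>i\<in>UNIV. ?n * \<bar>B i - 1 / ?n\<bar> * M)"
  proof (rule sum_norm_le)
    fix i :: 'n
    have "norm ((?n * (1 / ?n - B i)) *\<^sub>R u i) = ?n * \<bar>B i - 1 / ?n\<bar> * norm (u i)"
      by (simp add: abs_mult abs_minus_commute)
    also have "\<dots> \<le> ?n * \<bar>B i - 1 / ?n\<bar> * M" using u by (intro mult_left_mono) auto
    finally show "norm ((?n * (1 / ?n - B i)) *\<^sub>R u i) \<le> ?n * \<bar>B i - 1 / ?n\<bar> * M" .
  qed
  also have "\<dots> = ?n * M * (\<Sum>i\<in>UNIV. \<bar>B i - 1 / ?n\<bar>)"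
    by (simp add: sum_distrib_left mult_ac)
  also have "\<dots> \<le> ?n * M * (sqrt ?n * norm ((\<chi> i. B i - 1 / ?n) :: real ^ 'n))"
  proof (rule mult_left_mono)
    show "(\<Sum>i\<in>UNIV. \<bar>B i - 1 / ?n\<bar>) \<le> sqrt ?n * norm ((\<chi> i. B i - 1 / ?n) :: real ^ 'n)"
      using sum_abs_le_norm_vec[of "\<chi> i. B i - 1 / ?n"] by simp
    show "0 \<le> ?n * M" using order_trans[OF norm_ge_zero u] by simp
  qed
  finally show ?thesis by (simp add: u_def mult_ac)
qed

text \<open>Adds the cost of normalizing the block weights to the distance from the target, both
  scaled by \<open>n\<close>. A general normed space lets it serve objective and constraints
  alike.\<close>

lemma trimming_error:
  fixes v :: "'l \<Rightarrow> 'a::real_normed_vector" and g :: "'l \<Rightarrow> 'n::finite" and c :: "'l \<Rightarrow> real"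
  assumes B_def: "B = (\<lambda>i. \<Sum>l\<in>{l \<in> J. g l = i}. c l)"
    and J: "finite J" and c: "\<And>l. l \<in> J \<Longrightarrow> 0 \<le> c l" and B: "\<And>i. 0 < B i"
    and v: "\<And>l. l \<in> J \<Longrightarrow> norm (v l) \<le> M" and M: "0 \<le> M"
    and weights: "norm ((\<chi> i. B i - 1 / real CARD('n)) :: real ^ 'n) \<le> e"
    and target: "norm ((\<Sum>l\<in>J. c l *\<^sub>R v l) - z /\<^sub>R real CARD('n)) \<le> e"
  shows "norm ((\<Sum>i\<in>UNIV. \<Sum>l\<in>{l \<in> J. g l = i}. (c l / B i) *\<^sub>R v l) - z)
     \<le> real CARD('n) * (sqrt (real CARD('n)) * M + 1) * e"
proof -
  let ?n = "real CARD('n)"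
  let ?u = "\<Sum>i\<in>UNIV. \<Sum>l\<in>{l \<in> J. g l = i}. (c l / B i) *\<^sub>R v l"
  let ?x = "\<Sum>l\<in>J. c l *\<^sub>R v l"
  have "?u - z = (?u - ?n *\<^sub>R ?x) + ?n *\<^sub>R (?x - z /\<^sub>R ?n)"
    by (simp add: scaleR_diff_right)
  also have "norm \<dots> \<le> norm (?u - ?n *\<^sub>R ?x) + ?n * norm (?x - z /\<^sub>R ?n)"
    by (rule norm_triangle_le) simp
  also have "norm (?u - ?n *\<^sub>R ?x) \<le> ?n * sqrt ?n * M * norm ((\<chi> i. B i - 1 / ?n) :: real ^ 'n)"
    by (rule reweighting_error[OF B_def J c B v])
  also have "\<dots> \<le> ?n * sqrt ?n * M * e"
    using weights M by (intro mult_left_mono) auto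
  also have "?n * norm (?x - z /\<^sub>R ?n) \<le> ?n * e" using target by (intro mult_left_mono) auto
  finally show ?thesis by (simp add: algebra_simps)
qed

text \<open>A block represented by one atom has no defect, and one with \<open>p \<ge> 2\<close>
  atoms has at most one defect, charged \<open>p - 1\<close> times since \<open>N \<ge> 0\<close>.
  Every block is nonempty, so the charges add up to \<open>card J - n\<close>.\<close>

lemma sum_nonconvexity_le:
  fixes f :: "'n::finite \<Rightarrow> 'a::real_vector \<Rightarrow> ereal" and x :: "'l \<Rightarrow> 'a"
  assumes f: "\<And>i. proper (f i)" and J: "finite J" and c: "\<And>l. l \<in> J \<Longrightarrow> 0 \<le> c l"
    and sum1: "\<And>i. (\<Sum>l\<in>{l \<in> J. g l = i}. c l) = 1"
    and x: "\<And>l. l \<in> J \<Longrightarrow> x l \<in> edom (f (g l))"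
  shows "(\<Sum>i\<in>UNIV. f i (\<Sum>l\<in>{l \<in> J. g l = i}. c l *\<^sub>R x l))
    \<le> ereal (\<Sum>i\<in>UNIV. \<Sum>l\<in>{l \<in> J. g l = i}. c l * real_of_ereal (f (g l) (x l)))
       + ereal (real (card J) - real CARD('n)) * (MAX i. nonconvexity (f i))"
proof -
  define I where "I = (\<lambda>i. {l \<in> J. g l = i})"
  define R where "R = (\<lambda>i. \<Sum>l\<in>I i. c l * real_of_ereal (f (g l) (x l)))"
  define N where "N = (MAX i. nonconvexity (f i))"
  have finI: "finite (I i)" for i using J by (simp add: I_def)
  have card_I: "1 \<le> card (I i)" for i
  proof -
    have "sum c (I i) = 1" using sum1[of i] by (simp add: I_def)
    then have "I i \<noteq> {}" by (metis sum.empty zero_neq_one)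
    then show ?thesis using finI[of i] by (simp add: Suc_le_eq card_gt_0_iff)
  qed
  have N: "nonconvexity (f i) \<le> N" for i unfolding N_def by (intro Max_ge) auto
  have bound: "f i (\<Sum>l\<in>I i. c l *\<^sub>R x l) \<le> ereal (R i) + ereal (real (card (I i)) - 1) * N" for i
  proof (cases "card (I i) = 1")
    case True
    then obtain l where l: "I i = {l}" using card_1_singletonE by blast
    then have "l \<in> J" "g l = i" by (auto simp: I_def)
    moreover have "c l = 1" using sum1[of i] l by (simp add: I_def)
    ultimately show ?thesis
      using x[of l] proper_edom_real[OF f[of i], of "x l"] True by (simp add: l R_def flip: zero_ereal_def)
  next
    case False
    then have "1 \<le> real (card (I i)) - 1" using card_I[of i] by simp
    moreover have "0 \<le> N" using nonconvexity_nonneg[OF f] N order_trans by blast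
    ultimately have "1 * N \<le> ereal (real (card (I i)) - 1) * N"
      by (intro ereal_mult_right_mono) (auto simp: one_ereal_def)
    then have "nonconvexity (f i) \<le> ereal (real (card (I i)) - 1) * N"
      using N[of i] by simp
    moreover have "R i = (\<Sum>l\<in>I i. c l * real_of_ereal (f i (x l)))"
      unfolding R_def by (intro sum.cong) (auto simp: I_def)
    then have "f i (\<Sum>l\<in>I i. c l *\<^sub>R x l) \<le> ereal (R i) + nonconvexity (f i)"
      using sum1[of i] c x by (simp only:) (intro nonconvexity_upper[OF f finI]; auto simp: I_def)
    ultimately show ?thesis by (meson add_left_mono order_trans)
  qed
  have "(\<Sum>i\<in>UNIV. card (I i)) = card J"
    using sum.group[OF J, of UNIV g "\<lambda>_. 1 :: nat"] by (simp add: I_def)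
  then have cards: "(\<Sum>i\<in>UNIV. real (card (I i)) - 1) = real (card J) - real CARD('n)"
    by (simp add: sum_subtractf flip: of_nat_sum)
  have "(\<Sum>i\<in>UNIV. f i (\<Sum>l\<in>I i. c l *\<^sub>R x l))
      \<le> (\<Sum>i\<in>UNIV. ereal (R i) + ereal (real (card (I i)) - 1) * N)"
    by (intro sum_mono bound)
  \<comment> \<open>\<open>N\<close> may be infinite, so distributivity is applied with nonnegative
    factors only, as guaranteed by \<open>card_I\<close>.\<close>
  also have "\<dots> = ereal (\<Sum>i\<in>UNIV. R i) + (\<Sum>i\<in>UNIV. ereal (real (card (I i)) - 1)) * N"
    using card_I by (subst sum_ereal_left_distrib) (auto simp: sum.distrib)
  finally show ?thesis
    unfolding sum_ereal cards unfolding I_def R_def N_def .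
qed

lemma norm_fst_le_norm: "norm (fst p) \<le> norm p" and norm_snd_le_norm: "norm (snd p) \<le> norm p"
  by (metis norm_fst_le prod.collapse) (metis norm_snd_le prod.collapse)

text \<open>Passes from a real bound \<open>M\<close> on the finitely many atoms in use to the
  supremum \<open>M'\<close> over the domains, which may be infinite.\<close>

lemma Err_mono:
  assumes "0 \<le> h" "ereal M \<le> M'"
  shows "ereal (real n * (sqrt (real n) * M + 1) * (h * exp (- (real T * \<delta> / (8 * D\<^sup>2)))))
    \<le> Err n T M' h \<delta> D"
proof -
  have "ereal (sqrt (real n)) * ereal M + 1 \<le> ereal (sqrt (real n)) * M' + 1"
    using assms by (intro add_right_mono ereal_mult_left_mono) auto
  then have "Err n T (ereal M) h \<delta> D \<le> Err n T M' h \<delta> D"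
    unfolding Err_def using assms(1)
    by (intro ereal_mult_right_mono ereal_mult_left_mono) auto
  then show ?thesis by (simp add: Err_def one_ereal_def mult_ac)
qed

section \<open>The atoms and the target of the trimming stage\<close>

lemma finite_atoms: "finite (atoms f A y K)"
proof -
  have "atoms f A y K = (\<lambda>(k, i). atom f A y k i) ` ({..<K} \<times> UNIV)"
    by (fastforce simp: atoms_def image_iff)
  then show ?thesis by simp
qed

text \<open>Atom \<open>(k, i)\<close> gets weight \<open>\<gamma> k / n\<close>. Summing over the
  blocks restores the aggregates, and the axis vectors add up to the all-ones vector.\<close>

lemma trim_target_in_hull:
  fixes f :: "'n::finite \<Rightarrow> real ^ 'd::finite \<Rightarrow> ereal"
  assumes \<gamma>: "\<gamma> \<in> unit_simplex K" and z: "z = (\<Sum>k<K. \<gamma> k *\<^sub>R aggregate f A (y k))"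
  shows "trim_target z \<in> convex hull (atoms f A y K)"
proof -
  let ?n = "real CARD('n)"
  have "(\<Sum>i\<in>UNIV. (1 / ?n) *\<^sub>R atom f A y k i) \<in> convex hull (atoms f A y K)" if "k < K" for k
    using that by (intro convex_sum) (auto intro!: hull_inc simp: atoms_def)
  then have "(\<Sum>k<K. \<gamma> k *\<^sub>R (\<Sum>i\<in>UNIV. (1 / ?n) *\<^sub>R atom f A y k i)) \<in> convex hull (atoms f A y K)"
    by (rule convex_sum[rotated 4]) (use \<gamma> in \<open>auto simp: unit_simplex_def\<close>)
  also have "(\<Sum>k<K. \<gamma> k *\<^sub>R (\<Sum>i\<in>UNIV. (1 / ?n) *\<^sub>R atom f A y k i)) = trim_target z"
  proof -
    have axes: "(\<Sum>i\<in>UNIV. axis i (1::real)) = (\<chi> i::'n. 1)"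
      by (simp add: vec_eq_iff axis_def)
    have "(\<Sum>i\<in>UNIV. atom f A y k i)
        = (fst (aggregate f A (y k)), snd (aggregate f A (y k)), \<chi> i. 1)" for k
      by (simp add: prod_eq_iff fst_sum snd_sum atom_def aggregate_def axes)
    moreover have "(\<Sum>k<K. \<gamma> k *\<^sub>R ((\<chi> i. 1) :: real ^ 'n)) = (\<chi> i. 1)"
      using \<gamma> by (simp add: unit_simplex_def flip: scaleR_sum_left)
    moreover have "(\<Sum>k<K. \<gamma> k *\<^sub>R (\<Sum>i\<in>UNIV. (1 / ?n) *\<^sub>R atom f A y k i))
        = (1 / ?n) *\<^sub>R (\<Sum>k<K. \<gamma> k *\<^sub>R (\<Sum>i\<in>UNIV. atom f A y k i))"
      by (simp add: scaleR_sum_right mult.commute)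
    ultimately show ?thesis
      by (simp only:) (simp add: z trim_target_def prod_eq_iff fst_sum snd_sum inverse_eq_divide)
  qed
  finally show ?thesis .
qed

theorem corollary4p1:
  fixes blk :: "'d::finite \<Rightarrow> 'n::finite"
    and f :: "'n \<Rightarrow> real ^ 'd \<Rightarrow> ereal"
    and A :: "real ^ 'd ^ 'm::finite"
    and b :: "real ^ 'm"
    and vstar :: real
    and K T :: nat
    and y0 :: "'n \<Rightarrow> real ^ 'd"
    and y :: "nat \<Rightarrow> 'n \<Rightarrow> real ^ 'd"
    and \<eta> \<gamma> :: "nat \<Rightarrow> real"
    and z :: "nat \<Rightarrow> real \<times> (real ^ 'm)"
    and AK :: "(real \<times> (real ^ 'm) \<times> (real ^ 'n)) set"
    and q :: "real \<times> (real ^ 'm) \<times> (real ^ 'n)"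
    and s w :: "nat \<Rightarrow> real \<times> (real ^ 'm) \<times> (real ^ 'n)"
    and \<beta> :: "nat \<Rightarrow> nat \<Rightarrow> real"
    and i_of :: "nat \<Rightarrow> 'n"
    and k_of :: "nat \<Rightarrow> nat"
    and I :: "'n \<Rightarrow> nat set"
    and \<alpha> :: "nat \<Rightarrow> real"
    and h0 D \<delta> :: real
    and xbar :: "real ^ 'd"
  assumes dom_block: "\<And>i. edom (f i) \<subseteq> block_space blk i"
    and proper: "\<And>i. proper (f i)"
    and lsc: "\<And>i. lsc (f i)"
    and minorant: "\<And>i. has_affine_minorant (f i)"
    and compact_dom: "\<And>i. compact (edom (f i))"
    and convex_dom: "\<And>i. convex (edom (f i))"
    and dual_max: "is_dual_max blk f A b vstar"
    and strong_duality: "ereal vstar = convexified_value blk f A b"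
    and K: "K \<ge> 1"
    and fw: "frank_wolfe_stage f A (vstar, b) K y0 y \<eta> z"
    and \<gamma>: "\<gamma> \<in> unit_simplex K"
    and zK: "z K = (\<Sum>k<K. \<gamma> k *\<^sub>R aggregate f A (y k))"
    and AK: "AK = atoms f A y K"
    and two_atoms: "card AK \<ge> 2"
    and q: "q = trim_target (z K)"
    and T: "T \<ge> CARD('n) - 1"
    and trim: "fully_corrective_stage AK q T s \<beta> w"
    and atom_index: "\<And>l. l \<le> T \<Longrightarrow> k_of l < K \<and> s l = atom f A y (k_of l) (i_of l)"
    and I: "\<And>i. I i = {l. l \<le> T \<and> i_of l = i}"
    and \<alpha>: "\<And>l. l \<le> T \<Longrightarrow> \<alpha> l = \<beta> T l / (\<Sum>l'\<in>I (i_of l). \<beta> T l')"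
    and h0: "h0 = norm (w 0 - q)"
    and D: "D = diameter (convex hull AK)"
    and \<delta>: "\<delta> = max ((facial_distance AK)\<^sup>2) ((relative_radius q AK)\<^sup>2)"
    and accuracy: "1 / real CARD('n) > h0 * exp (- (real T / 8) * (\<delta> / D\<^sup>2))"
    and xbar: "\<And>i. block blk i xbar = (\<Sum>l\<in>I i. \<alpha> l *\<^sub>R y (k_of l) i)"
  shows "(\<Sum>i\<in>UNIV. f i (block blk i xbar))
           \<le> ereal vstar + 2 * D_C f A / ereal (sqrt (real K + 1))
               + Err CARD('n) T (max_abs_value f) h0 \<delta> D
               + ereal (real T + 1 - real CARD('n)) * (MAX i. nonconvexity (f i))
         \<and> ereal (norm_plus ((\<Sum>i\<in>UNIV. A *v block blk i xbar) - b))
           \<le> 2 * D_C f A / ereal (sqrt (real K + 1))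
               + Err CARD('n) T (max_norm_image f A) h0 \<delta> D"
proof -
  let ?n = "real CARD('n)"

  \<comment> \<open>Residual of the trimming stage, component by component\<close>
  define e where "e = h0 * exp (- (real T * \<delta> / (8 * D\<^sup>2)))"
  define c where "c = \<beta> T"
  define x where "x = (\<lambda>l. y (k_of l) (i_of l))"
  define F where "F = (\<lambda>l. real_of_ereal (f (i_of l) (x l)))"
  define B where "B = (\<lambda>i. \<Sum>l\<in>{l \<in> {..T}. i_of l = i}. c l)"
  have h0_nonneg: "0 \<le> h0" by (simp add: h0)
  have I_eq: "I i = {l \<in> {..T}. i_of l = i}" for i by (auto simp: I)
  have x_dom: "x l \<in> edom (f (i_of l))" if "l \<le> T" for l
    using fw atom_index[OF that] unfolding frank_wolfe_stage_def Let_def x_def by blast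
  have s_eq: "s l = (F l, A *v x l, axis (i_of l) 1)" if "l \<le> T" for l
    using atom_index[OF that] by (simp add: atom_def F_def x_def)
  have s_AK: "s l \<in> AK" if "l \<le> T" for l
    using atom_index[OF that] by (auto simp: AK atoms_def)
  have q_hull: "q \<in> convex hull AK"
    unfolding q AK using \<gamma> zK by (rule trim_target_in_hull)
  have wT: "norm (w T - q) \<le> e"
    unfolding e_def h0
    by (rule fully_corrective_linear_convergence[OF trim _ s_AK q_hull \<delta> D])
      (simp_all add: AK finite_atoms)
  note iterate = fully_corrective_iterate[OF trim order_refl, folded c_def]
  have c_pos: "0 \<le> c l" if "l \<le> T" for l using iterate(1) that by (simp add: unit_simplex_def)
  \<comment> \<open>The axis component of the iterate records the block weights \<open>B\<close>, so
    the residual also controls how far they are from \<open>1 / n\<close>.\<close>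
  have w_eq: "w T = ((\<Sum>l\<le>T. c l *\<^sub>R F l), (\<Sum>l\<le>T. c l *\<^sub>R (A *v x l)), \<chi> i. B i)"
  proof -
    have "(\<Sum>l\<le>T. c l *\<^sub>R axis (i_of l) (1::real)) = (\<chi> i. B i)"
    proof -
      have "(\<Sum>l\<le>T. c l * axis (i_of l) 1 $ i) = B i" for i
        unfolding B_def sum.inter_filter[OF finite_atMost]
        by (intro sum.cong) (auto simp: axis_def)
      then show ?thesis by (simp add: vec_eq_iff)
    qed
    then show ?thesis
      by (simp add: iterate(2) s_eq prod_eq_iff fst_sum snd_sum)
  qed
  have q_eq: "q = (fst (z K) /\<^sub>R ?n, snd (z K) /\<^sub>R ?n, \<chi> i. 1 / ?n)"
    by (simp add: q trim_target_def vec_eq_iff inverse_eq_divide)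
  have errF: "norm ((\<Sum>l\<le>T. c l *\<^sub>R F l) - fst (z K) /\<^sub>R ?n) \<le> e"
    using order_trans[OF norm_fst_le_norm wT[unfolded w_eq q_eq]] by simp
  have wT2: "norm (snd (w T - q)) \<le> e"
    by (rule order_trans[OF norm_snd_le_norm wT])
  have errA: "norm ((\<Sum>l\<le>T. c l *\<^sub>R (A *v x l)) - snd (z K) /\<^sub>R ?n) \<le> e"
    using order_trans[OF norm_fst_le_norm wT2[unfolded w_eq q_eq]] by simp
  have errB: "norm ((\<chi> i. B i - 1 / ?n) :: real ^ 'n) \<le> e"
  proof -
    have "(\<chi> i. B i) - (\<chi> i. 1 / ?n) = ((\<chi> i. B i - 1 / ?n) :: real ^ 'n)"
      by (simp add: vec_eq_iff)
    then show ?thesis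
      using order_trans[OF norm_snd_le_norm wT2[unfolded w_eq q_eq]] by simp
  qed
  \<comment> \<open>A deviation of at most \<open>e\<close> from \<open>1 / n\<close>, with strict
    inequality here, excludes \<open>B i \<le> 0\<close>: no block is lost.\<close>
  have "e < 1 / ?n"
    using accuracy by (simp add: e_def mult_ac)
  then have B_pos: "0 < B i" for i
    using order_trans[OF component_le_norm_cart[of "\<chi> i. B i - 1 / ?n" i] errB] by simp
  have x_avg: "block blk i xbar = (\<Sum>l\<in>{l \<in> {..T}. i_of l = i}. (c l / B i) *\<^sub>R x l)" for i
    unfolding xbar I_eq by (intro sum.cong) (auto simp: \<alpha> I_eq B_def c_def x_def)

  \<comment> \<open>Finite bounds on the atoms in use\<close>
  define MF where "MF = Max ((\<lambda>l. norm (F l)) ` {..T})"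
  define MA where "MA = Max ((\<lambda>l. norm (A *v x l)) ` {..T})"
  have MF: "norm (F l) \<le> MF" and MA: "norm (A *v x l) \<le> MA" if "l \<le> T" for l
    using that by (auto simp: MF_def MA_def intro!: Max_ge)
  have M_nonneg: "0 \<le> MF" "0 \<le> MA" using MF[of 0] MA[of 0] norm_ge_zero order_trans by blast+
  have MF_le: "ereal MF \<le> max_abs_value f"
  proof -
    have "MF \<in> (\<lambda>l. norm (F l)) ` {..T}" unfolding MF_def by (intro Max_in) auto
    then obtain l where l: "l \<le> T" "MF = \<bar>F l\<bar>" by auto
    then have "ereal MF = \<bar>f (i_of l) (x l)\<bar>"
      using proper_edom_real[OF proper x_dom[OF l(1)]] by (metis F_def abs_ereal.simps(1))
    also have "\<dots> \<le> max_abs_value f"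
      unfolding max_abs_value_def
      by (intro SUP_upper2[of "i_of l"] SUP_upper2[of "x l"] x_dom l) auto
    finally show ?thesis .
  qed
  have MA_le: "ereal MA \<le> max_norm_image f A"
  proof -
    have "MA \<in> (\<lambda>l. norm (A *v x l)) ` {..T}" unfolding MA_def by (intro Max_in) auto
    then obtain l where l: "l \<le> T" "MA = norm (A *v x l)" by auto
    then show ?thesis
      unfolding max_norm_image_def
      by (intro SUP_upper2[of "i_of l"] SUP_upper2[of "x l"] x_dom) auto
  qed
  define EF where "EF = ?n * (sqrt ?n * MF + 1) * e"
  define EA where "EA = ?n * (sqrt ?n * MA + 1) * e"
  have EF_le: "ereal EF \<le> Err CARD('n) T (max_abs_value f) h0 \<delta> D"
    unfolding EF_def e_def by (rule Err_mono[OF h0_nonneg MF_le])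
  have EA_le: "ereal EA \<le> Err CARD('n) T (max_norm_image f A) h0 \<delta> D"
    unfolding EA_def e_def by (rule Err_mono[OF h0_nonneg MA_le])

  \<comment> \<open>Block-wise averages compared with the Frank-Wolfe output\<close>
  define SF where "SF = (\<Sum>i\<in>UNIV. \<Sum>l\<in>{l \<in> {..T}. i_of l = i}. (c l / B i) * F l)"
  define SA where "SA = (\<Sum>i\<in>UNIV. \<Sum>l\<in>{l \<in> {..T}. i_of l = i}. (c l / B i) *\<^sub>R (A *v x l))"
  have SF: "\<bar>SF - fst (z K)\<bar> \<le> EF"
    using trimming_error[OF B_def finite_atMost, of F MF e "fst (z K)"]
      c_pos B_pos MF M_nonneg errB errF
    by (simp add: SF_def EF_def)
  have SA: "norm (SA - snd (z K)) \<le> EA"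
    using trimming_error[OF B_def finite_atMost, of "\<lambda>l. A *v x l" MA e "snd (z K)"]
      c_pos B_pos MA M_nonneg errB errA
    by (simp add: SA_def EA_def)
  have SA_eq: "(\<Sum>i\<in>UNIV. A *v block blk i xbar) = SA"
    by (simp add: SA_def x_avg matrix_vector_mult_sum_right matrix_vector_mult_scaleR)

  define N where "N = (MAX i. nonconvexity (f i))"
  \<comment> \<open>The indices \<open>0\<close> to \<open>T\<close> count \<open>T + 1\<close>
    atoms, repetitions included; one per block leaves \<open>T + 1 - n\<close> to be
    charged.\<close>
  have f_le: "(\<Sum>i\<in>UNIV. f i (block blk i xbar)) \<le> ereal SF + ereal (real T + 1 - ?n) * N"
  proof -
    have "0 \<le> c l / B (i_of l)" if "l \<le> T" for l using c_pos[OF that] B_pos[of "i_of l"] by simp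
    moreover have "(\<Sum>l\<in>{l \<in> {..T}. i_of l = i}. c l / B (i_of l)) = 1" for i
    proof -
      have "(\<Sum>l\<in>{l \<in> {..T}. i_of l = i}. c l / B (i_of l)) = (\<Sum>l\<in>{l \<in> {..T}. i_of l = i}. c l) / B i"
        unfolding sum_divide_distrib by (intro sum.cong) auto
      also have "\<dots> = B i / B i" by (simp add: B_def)
      finally show ?thesis using B_pos[of i] by simp
    qed
    ultimately have "(\<Sum>i\<in>UNIV. f i (\<Sum>l\<in>{l \<in> {..T}. i_of l = i}. (c l / B (i_of l)) *\<^sub>R x l))
      \<le> ereal (\<Sum>i\<in>UNIV. \<Sum>l\<in>{l \<in> {..T}. i_of l = i}. (c l / B (i_of l)) * real_of_ereal (f (i_of l) (x l)))
       + ereal (real (card {..T}) - ?n) * N"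
      unfolding N_def by (intro sum_nonconvexity_le proper x_dom) auto
    moreover have "(\<Sum>l\<in>{l \<in> {..T}. i_of l = i}. (c l / B (i_of l)) *\<^sub>R x l) = block blk i xbar" for i
      unfolding x_avg by (intro sum.cong) auto
    moreover have "(\<Sum>l\<in>{l \<in> {..T}. i_of l = i}. (c l / B (i_of l)) * real_of_ereal (f (i_of l) (x l)))
        = (\<Sum>l\<in>{l \<in> {..T}. i_of l = i}. (c l / B i) * F l)" for i
      unfolding F_def by (intro sum.cong) auto
    ultimately show ?thesis by (simp add: SF_def add.commute)
  qed

  \<comment> \<open>Combination of the two stages\<close>
  have "0 \<le> D_C f A"
  proof -
    have "z 0 = aggregate f A y0" "aggregate f A y0 \<in> C_set f A"
      using fw unfolding frank_wolfe_stage_def Let_def by (blast intro: aggregate_in_C_set)+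
    then show ?thesis
      unfolding D_C_def by (intro SUP_upper2[of "z 0"]) auto
  qed
  then consider "D_C f A = \<infinity>" | DC where "D_C f A = ereal DC" by (cases "D_C f A") auto
  then show ?thesis
  proof cases
    case 1
    \<comment> \<open>An infinite diameter makes both right-hand sides infinite.\<close>
    then show ?thesis by simp
  next
    case 2
    define E where "E = 2 * DC / sqrt (real K + 1)"
    have E: "2 * D_C f A / ereal (sqrt (real K + 1)) = ereal E"
      by (simp add: 2 E_def)
    have conv: "norm (sup (z K - (vstar, b)) 0) \<le> E"
      unfolding E_def
      by (rule frank_wolfe_convergence[OF proper minorant convex_dom strong_duality[symmetric] K fw 2])
    have "\<bar>sup (fst (z K) - vstar) 0\<bar> \<le> E"
      using order_trans[OF norm_fst_le_norm conv] by simp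
    then have "SF \<le> vstar + E + EF"
      using SF by (simp add: sup_real_def) linarith
    then have "ereal SF \<le> ereal vstar + ereal E + ereal EF" by simp
    also have "\<dots> \<le> ereal vstar + ereal E + Err CARD('n) T (max_abs_value f) h0 \<delta> D"
      using EF_le by (rule add_left_mono)
    finally have first: "ereal SF + ereal (real T + 1 - ?n) * N
      \<le> ereal vstar + ereal E + Err CARD('n) T (max_abs_value f) h0 \<delta> D + ereal (real T + 1 - ?n) * N"
      by (rule add_right_mono)
    \<comment> \<open>The residual is that of \<open>z K\<close> shifted by the trimming error, and
      the shift can be taken out of the positive part.\<close>
    have "norm_plus (SA - b) = norm (sup ((snd (z K) - b) + (SA - snd (z K))) 0)"
      by (simp add: norm_plus_eq_norm_sup)
    also have "\<dots> \<le> norm (sup (snd (z K) - b) 0 + (SA - snd (z K)))"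
      by (rule norm_sup_add_le_vec)
    also have "\<dots> \<le> norm (sup (snd (z K) - b) 0) + norm (SA - snd (z K))"
      by (rule norm_triangle_ineq)
    also have "\<dots> \<le> E + EA"
      using order_trans[OF norm_snd_le_norm conv] SA by (intro add_mono) simp_all
    finally have "ereal (norm_plus (SA - b)) \<le> ereal E + ereal EA" by simp
    also have "\<dots> \<le> ereal E + Err CARD('n) T (max_norm_image f A) h0 \<delta> D"
      using EA_le by (rule add_left_mono)
    finally have second: "ereal (norm_plus (SA - b)) \<le> ereal E + Err CARD('n) T (max_norm_image f A) h0 \<delta> D" .
    show ?thesis
      unfolding E SA_eq N_def[symmetric] using order_trans[OF f_le first] second by blast
  qed
qed

end
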